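(* Let $G$ be a finite undirected graph and let $\mathcal{F}$ be the set of all sub-forests of $G$. Let $\mu = \frac{1}{|\mathcal{F}|}\sum_{F\in\mathcal{F}} |F|$ be the average forest size. Then the proportion of sub-forests of size smaller than $\mu+1$ is at least $1/e$: $$\frac{|\{F\in\mathcal{F} : |F| < \mu+1\}|}{|\mathcal{F}|}\geq \frac1e.$$
   Context: A sub-forest of $G$ is a set $F$ of edges of $G$ containing no cycle (equivalently, an independent set of the graphic matroid of $G$; the empty set is included), and its size $|F|$ is its number of edges. *)

theory Defs
  imports Complex_Main
begin

text \<open>
  Undirected graphs may have loops and parallel edges, as is usual for graphic matroids:
  edges are abstract objects, and an edge \<open>e\<close> is mapped to its set of endpoints, which has one
  element if \<open>e\<close> is a loop and two otherwise. A simple graph is the case in which \<open>ends\<close> is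
  the identity on a set of two-element sets of vertices.
\<close>

locale finite_graph =
  fixes V :: "'v set" and E :: "'e set" and ends :: "'e \<Rightarrow> 'v set"
  assumes finite_V: "finite V"
    and finite_E: "finite E"
    and ends_subset: "e \<in> E \<Longrightarrow> ends e \<subseteq> V"
    and card_ends: "e \<in> E \<Longrightarrow> card (ends e) \<in> {1, 2}"

text \<open>
  A cycle of length \<open>k \<ge> 1\<close> passes through distinct vertices \<open>v\<^sub>0, \<dots>, v\<^sub>k\<^sub>-\<^sub>1\<close> along distinct edges
  \<open>e\<^sub>0, \<dots>, e\<^sub>k\<^sub>-\<^sub>1\<close>, where \<open>e\<^sub>i\<close> joins \<open>v\<^sub>i\<close> to its cyclic successor. For \<open>k = 1\<close> it is a loop, and
  for \<open>k = 2\<close> a pair of parallel edges; distinctness of the edges rules out traversing one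
  edge back and forth.
\<close>

definition is_cycle :: "('e \<Rightarrow> 'v set) \<Rightarrow> 'v list \<Rightarrow> 'e list \<Rightarrow> bool" where
  "is_cycle ends vs es \<longleftrightarrow>
     es \<noteq> [] \<and> length vs = length es \<and> distinct vs \<and> distinct es \<and>
     (\<forall>i < length es. ends (es ! i) = {vs ! i, vs ! (Suc i mod length es)})"

definition sub_forests :: "'e set \<Rightarrow> ('e \<Rightarrow> 'v set) \<Rightarrow> 'e set set" where
  "sub_forests E ends = {F. F \<subseteq> E \<and> \<not> (\<exists>vs es. is_cycle ends vs es \<and> set es \<subseteq> F)}"

definition avg_forest_size :: "'e set \<Rightarrow> ('e \<Rightarrow> 'v set) \<Rightarrow> real" where
  "avg_forest_size E ends =
     1 / real (card (sub_forests E ends)) * (\<Sum>F\<in>sub_forests E ends. real (card F))"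

lemma empty_in_sub_forests: "{} \<in> sub_forests E ends"
  by (auto simp: sub_forests_def is_cycle_def)

lemma (in finite_graph) finite_sub_forests: "finite (sub_forests E ends)"
  by (rule finite_subset[of _ "Pow E"]) (auto simp: sub_forests_def finite_E)

end

theory Submission
  imports Defs "Jordan_Normal_Form.Determinant" "HOL-Library.Multiset"
begin

text \<open>
  The inequality follows from one property of the numbers \<open>I\<^sub>k\<close> of sub-forests with \<open>k\<close> edges: they
  form a log-concave sequence without internal zeros.

  From log-concavity to the bound (\<open>log_concave_Feige\<close>). Let \<open>X\<close> be the size of a uniformly random
  sub-forest and \<open>F\<close> its distribution function, which is again log-concave. Then \<open>E ln F(X) \<ge> -1\<close>,
  as \<open>F(X)\<close> is stochastically larger than a uniform variable, and Jensen's inequality for the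
  concave function \<open>ln F\<close> yields \<open>ln F(\<lceil>\<mu>\<rceil>) \<ge> -1\<close>. The event \<open>X < \<mu> + 1\<close> is \<open>X \<le> \<lceil>\<mu>\<rceil>\<close>.

  Log-concavity (\<open>count_indep_Mason\<close>) is a theorem about matroids, proved through Lorentzian
  polynomials. For the polynomial \<open>\<Sum>\<^sub>T y\<^bsup>d - |T|\<^esup> / (d - |T|)! \<Prod>\<^sub>e\<^sub>\<in>\<^sub>T z\<^sub>e\<close> over the independent sets \<open>T\<close>
  of size at most \<open>d\<close>, all Hessians of derivatives, at points with positive coordinates, have at
  most one positive eigenvalue. This is shown by induction on the degree. For quadratic derivatives
  it reflects that parallelism in a contraction is an equivalence relation
  (\<open>\<chi>_reverse_Cauchy_Schwarz\<close>). The induction step is a local-to-global principle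
  (\<open>ext_sum_reverse_Cauchy_Schwarz\<close>): by Euler's identity, the inequalities for the partial
  derivatives add up to \<open>P \<le> P\<^sup>2\<close> for the normalised Hessian \<open>P\<close>, a stochastic matrix, so that
  \<open>P\<close> has no eigenvalue strictly between 0 and 1 (\<open>reverse_Cauchy_Schwarz_of_gap\<close>). The signature
  of the Hessian on the span of \<open>y\<close> and the evaluation point, as the point tends to \<open>y = 0\<close>, is
  the inequality between \<open>I\<^sub>k\<^sub>-\<^sub>1\<close>, \<open>I\<^sub>k\<close> and \<open>I\<^sub>k\<^sub>+\<^sub>1\<close>.

  For forests of a graph, two edges are parallel after contracting a forest exactly if they join
  the same two of its components (\<open>insert_insert_sub_forest_iff\<close>).
\<close>

section \<open>Log-concave distributions and their mean\<close>

text \<open>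
  A discrete form of \<open>\<integral> ln u du = u ln u - u\<close>: each summand dominates the increment of the
  antiderivative over \<open>[F (k - 1), F k]\<close>, because \<open>ln\<close> is increasing.
\<close>

lemma sum_log_cdf_ge:
  fixes p :: "nat \<Rightarrow> real"
  assumes "\<And>k. p k \<ge> 0" and "p 0 > 0"
  defines "F \<equiv> \<lambda>k. \<Sum>i\<le>k. p i"
  shows "F n * ln (F n) - F n \<le> (\<Sum>k\<le>n. p k * ln (F k))"
proof (induction n)
  case 0
  then show ?case
    using assms(2) by (simp add: F_def)
next
  case (Suc n)
  have pos: "F k > 0" for k
  proof -
    have "p 0 \<le> F k"
      unfolding F_def by (rule member_le_sum) (auto simp: assms(1))
    then show ?thesis
      using assms(2) by linarith
  qed
  have step: "F (Suc n) = F n + p (Suc n)"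
    by (simp add: F_def)
  have "F n * (ln (F (Suc n)) - ln (F n)) = F n * ln (F (Suc n) / F n)"
    using pos[of n] pos[of "Suc n"] by (simp add: ln_divide_pos)
  also have "\<dots> \<le> F n * (F (Suc n) / F n - 1)"
    using pos[of n] pos[of "Suc n"] by (intro mult_left_mono ln_le_minus_one) auto
  also have "\<dots> = p (Suc n)"
    using pos[of n] step by (simp add: field_simps)
  finally have "F n * (ln (F (Suc n)) - ln (F n)) \<le> p (Suc n)" .
  then have "F (Suc n) * ln (F (Suc n)) - F (Suc n)
      \<le> F n * ln (F n) - F n + p (Suc n) * ln (F (Suc n))"
    by (simp add: step algebra_simps)
  then show ?case
    using Suc.IH by simp
qed

lemma antitone_differences_below_tangent:
  fixes l :: "nat \<Rightarrow> real"
  assumes "\<And>i j. i \<le> j \<Longrightarrow> l (Suc j) - l j \<le> l (Suc i) - l i"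
  shows "l k \<le> l m + (l (Suc m) - l m) * (real k - real m)"
proof (cases "m \<le> k")
  case True
  have "l (m + d) \<le> l m + (l (Suc m) - l m) * real d" for d
  proof (induction d)
    case (Suc d)
    have "l (m + Suc d) - l (m + d) \<le> l (Suc m) - l m"
      using assms[of m "m + d"] by simp
    with Suc show ?case
      by (simp add: algebra_simps)
  qed simp
  from this[of "k - m"] show ?thesis
    using True by (simp add: of_nat_diff)
next
  case False
  have "d \<le> m \<Longrightarrow> l (m - d) \<le> l m - (l (Suc m) - l m) * real d" for d
  proof (induction d)
    case (Suc d)
    then have eq: "m - d = Suc (m - Suc d)"
      by simp
    have "l (Suc m) - l m \<le> l (m - d) - l (m - Suc d)"
      using assms[of "m - Suc d" m] unfolding eq by simp
    with Suc show ?case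
      by (simp add: algebra_simps)
  qed simp
  from this[of "m - k"] show ?thesis
    using False by (simp add: of_nat_diff algebra_simps)
qed

text \<open>
  The difference of the two sides is \<open>c\<^sub>k\<^sub>+\<^sub>1 C\<^sub>k\<^sub>+\<^sub>1 - c\<^sub>k\<^sub>+\<^sub>2 C\<^sub>k\<close> for the partial sums \<open>C\<close>, and the
  hypothesis compares the two products term by term.
\<close>

lemma partial_sums_log_concave:
  fixes c :: "nat \<Rightarrow> real"
  assumes nonneg: "\<And>k. c k \<ge> 0" and lc: "\<And>i k. i \<le> k \<Longrightarrow> c (Suc k) * c i \<le> c k * c (Suc i)"
  shows "(\<Sum>i\<le>k. c i) * (\<Sum>i\<le>Suc (Suc k). c i) \<le> (\<Sum>i\<le>Suc k. c i)\<^sup>2"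
proof -
  have "c (Suc (Suc k)) * (\<Sum>i\<le>k. c i) = (\<Sum>i\<le>k. c (Suc (Suc k)) * c i)"
    by (rule sum_distrib_left)
  also have "\<dots> \<le> (\<Sum>i\<le>k. c (Suc k) * c (Suc i))"
    by (intro sum_mono lc) auto
  also have "\<dots> = c (Suc k) * (\<Sum>i\<le>k. c (Suc i))"
    by (rule sum_distrib_left[symmetric])
  also have "\<dots> \<le> c (Suc k) * (\<Sum>i\<le>Suc k. c i)"
    unfolding sum.atMost_Suc_shift[of c k] using nonneg by (intro mult_left_mono) auto
  finally show ?thesis
    by (simp add: power2_eq_square algebra_simps)
qed

text \<open>
  Let \<open>F\<close> be the distribution function of a random variable \<open>X\<close> with weights \<open>c\<close>. It is log-concave
  and increasing, so at \<open>m = \<lceil>\<mu>\<rceil>\<close> the function \<open>ln F\<close> lies below a line of slope \<open>s \<ge> 0\<close>. Taking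
  expectations, \<open>E ln F(X) \<le> ln F(m) + s (\<mu> - m) \<le> ln F(m)\<close>. On the other hand \<open>E ln F(X) \<ge> -1\<close>,
  since \<open>F(X)\<close> is stochastically larger than a uniform variable on \<open>[0, 1]\<close>. Hence \<open>F(m) \<ge> 1/e\<close>, and
  \<open>X \<le> m\<close> is the event \<open>X < \<mu> + 1\<close>.
\<close>

lemma log_concave_Feige:
  fixes c :: "nat \<Rightarrow> real"
  assumes nonneg: "\<And>k. c k \<ge> 0" and c0: "c 0 > 0"
    and lc: "\<And>i k. i \<le> k \<Longrightarrow> c (Suc k) * c i \<le> c k * c (Suc i)"
    and zero: "\<And>k. k > n \<Longrightarrow> c k = 0"
  defines "t \<equiv> \<Sum>k\<le>n. c k"
  defines "\<mu> \<equiv> (\<Sum>k\<le>n. real k * c k) / t"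
  shows "(\<Sum>k | k \<le> n \<and> real k < \<mu> + 1. c k) / t \<ge> 1 / exp 1"
proof -
  define F where "F k = (\<Sum>i\<le>k. c i / t)" for k
  have "c 0 \<le> t"
    unfolding t_def by (rule member_le_sum) (auto simp: nonneg)
  then have t: "t > 0"
    using c0 by linarith
  have Fpos: "F k > 0" for k
  proof -
    have "c 0 / t \<le> F k"
      unfolding F_def by (rule member_le_sum) (use nonneg t in auto)
    then show ?thesis
      using c0 t by (meson divide_pos_pos less_le_trans)
  qed
  have Fn: "F n = 1"
    using t by (simp add: F_def t_def sum_divide_distrib[symmetric])
  define l where "l k = ln (F k)" for k
  have l_step: "l (Suc (Suc k)) - l (Suc k) \<le> l (Suc k) - l k" for k
  proof -
    have "F k * F (Suc (Suc k)) \<le> (F (Suc k))\<^sup>2"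
      unfolding F_def by (rule partial_sums_log_concave)
        (use nonneg t lc in \<open>auto simp: divide_right_mono\<close>)
    then have "ln (F k * F (Suc (Suc k))) \<le> ln ((F (Suc k))\<^sup>2)"
      using Fpos by (intro ln_mono) auto
    then show ?thesis
      using Fpos[of k] Fpos[of "Suc k"] Fpos[of "Suc (Suc k)"]
      by (simp add: l_def ln_mult ln_realpow)
  qed
  have diffs: "l (Suc j) - l j \<le> l (Suc i) - l i" if "i \<le> j" for i j
    using that by (induction rule: dec_induct) (use l_step order_trans in blast)+
  define m where "m = nat \<lceil>\<mu>\<rceil>"
  have "\<mu> \<ge> 0"
    unfolding \<mu>_def using t nonneg by (intro divide_nonneg_pos sum_nonneg) auto
  then have m: "\<mu> \<le> real m" and below: "real k < \<mu> + 1 \<longleftrightarrow> k \<le> m" for k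
    unfolding m_def by linarith+
  define s where "s = l (Suc m) - l m"
  have "F m \<le> F (Suc m)"
    using nonneg t by (simp add: F_def)
  then have s: "s \<ge> 0"
    using Fpos[of m] Fpos[of "Suc m"] by (simp add: s_def l_def)
  have sum1: "(\<Sum>k\<le>n. c k / t) = 1"
    using Fn by (simp add: F_def)
  have "-1 = F n * ln (F n) - F n"
    by (simp add: Fn)
  also have "\<dots> \<le> (\<Sum>k\<le>n. c k / t * l k)"
    using sum_log_cdf_ge[of "\<lambda>k. c k / t" n] nonneg c0 t by (simp add: F_def l_def)
  also have "\<dots> \<le> (\<Sum>k\<le>n. c k / t * (l m + s * (real k - real m)))"
    unfolding s_def using antitone_differences_below_tangent[of l, OF diffs] nonneg t
    by (intro sum_mono mult_left_mono) auto
  also have "\<dots> = (l m - s * real m) * (\<Sum>k\<le>n. c k / t) + s * (\<Sum>k\<le>n. real k * c k / t)"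
    by (simp add: algebra_simps sum.distrib sum_subtractf sum_distrib_left)
  also have "\<dots> = l m + s * (\<mu> - real m)"
    unfolding sum1 by (simp add: \<mu>_def sum_divide_distrib algebra_simps)
  also have "\<dots> \<le> l m"
    using s m by (simp add: mult_nonneg_nonpos)
  finally have "exp (-1) \<le> F m"
    unfolding l_def using Fpos[of m] by (simp add: ln_ge_iff)
  also have "F m = (\<Sum>k | k \<le> n \<and> real k < \<mu> + 1. c k / t)"
    unfolding F_def below by (rule sum.mono_neutral_right) (use zero not_le in auto)
  finally show ?thesis
    by (simp add: sum_divide_distrib exp_minus inverse_eq_divide)
qed

section \<open>Symmetric matrices with a spectral gap\<close>

text \<open>
  The Fredholm alternative for square systems, with the matrix indexed by an arbitrary finite
  set. Transporting it to a matrix over \<open>{0..<n}\<close> makes the adjugate available, which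
  supplies the solution once the determinant is seen to be nonzero.
\<close>

lemma square_system_solvable:
  fixes a :: "'i \<Rightarrow> 'i \<Rightarrow> real"
  assumes "finite S"
    and inj: "\<And>x. (\<And>i. i \<in> S \<Longrightarrow> (\<Sum>j\<in>S. a i j * x j) = 0) \<Longrightarrow> (\<And>j. j \<in> S \<Longrightarrow> x j = 0)"
  shows "\<exists>x. \<forall>i\<in>S. (\<Sum>j\<in>S. a i j * x j) = b i"
proof -
  define n where "n = card S"
  obtain h where h: "bij_betw h {0..<n} S"
    using ex_bij_betw_nat_finite[OF \<open>finite S\<close>] n_def by blast
  define g where "g = the_inv_into {0..<n} h"
  have g: "g i < n" "h (g i) = i" if "i \<in> S" for i
    using that h the_inv_into_into[of h "{0..<n}" i "{0..<n}"] f_the_inv_into_f_bij_betw[OF h, of i]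
    by (auto simp: g_def bij_betw_def)
  have hS: "h k \<in> S" if "k < n" for k
    using h that by (auto simp: bij_betw_def)
  have gh: "g (h k) = k" if "k < n" for k
    using h that by (auto simp: g_def bij_betw_def intro: the_inv_into_f_f)
  have reindex: "(\<Sum>j\<in>S. f j) = (\<Sum>k=0..<n. f (h k))" for f :: "'i \<Rightarrow> real"
    using sum.reindex_bij_betw[OF h] by metis
  define A where "A = mat n n (\<lambda>(p, q). a (h p) (h q))"
  have A: "A \<in> carrier_mat n n"
    by (simp add: A_def)
  have mult: "(A *\<^sub>v v) $ p = (\<Sum>q=0..<n. a (h p) (h q) * v $ q)"
    if "v \<in> carrier_vec n" "p < n" for v p
    using that by (simp add: A_def scalar_prod_def)
  have "det A \<noteq> 0"
  proof
    assume "det A = 0"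
    then obtain v where v: "v \<in> carrier_vec n" "v \<noteq> 0\<^sub>v n" "A *\<^sub>v v = 0\<^sub>v n"
      using det_0_iff_vec_prod_zero_field[OF A] by blast
    have "(\<Sum>j\<in>S. a i j * v $ g j) = 0" if "i \<in> S" for i
    proof -
      have "(\<Sum>j\<in>S. a i j * v $ g j) = (\<Sum>q=0..<n. a (h (g i)) (h q) * v $ q)"
        unfolding reindex by (intro sum.cong) (auto simp: gh g that)
      also have "\<dots> = (A *\<^sub>v v) $ g i"
        using mult[OF v(1)] g that by simp
      also have "\<dots> = 0"
        using v(3) g that by simp
      finally show ?thesis .
    qed
    from inj[OF this] have "v $ g j = 0" if "j \<in> S" for j
      using that by blast
    then have "v $ k = 0" if "k < n" for k
      using hS[OF that] gh[OF that] by metis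
    then show False
      using v(1,2) by auto
  qed
  define w where "w = (1 / det A) \<cdot>\<^sub>v (adj_mat A *\<^sub>v vec n (\<lambda>p. b (h p)))"
  have w: "w \<in> carrier_vec n"
    using adj_mat(1)[OF A] by (simp add: w_def)
  have "A *\<^sub>v w = (1 / det A) \<cdot>\<^sub>v ((A * adj_mat A) *\<^sub>v vec n (\<lambda>p. b (h p)))"
    unfolding w_def using A adj_mat(1)[OF A]
    by (subst mult_mat_vec[where nr = n and nc = n]) auto
  also have "\<dots> = vec n (\<lambda>p. b (h p))"
    unfolding adj_mat(2)[OF A] using \<open>det A \<noteq> 0\<close>
    by (intro eq_vecI) (auto simp: scalar_prod_def sum_distrib_left[symmetric] mult.assoc
        if_distrib[of "\<lambda>x. x * _"] if_distrib[of "\<lambda>x. _ * x"] cong: if_cong)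
  finally have Aw: "A *\<^sub>v w = vec n (\<lambda>p. b (h p))" .
  have "(\<Sum>j\<in>S. a i j * w $ g j) = b i" if "i \<in> S" for i
  proof -
    have "(\<Sum>j\<in>S. a i j * w $ g j) = (\<Sum>q=0..<n. a (h (g i)) (h q) * w $ q)"
      unfolding reindex by (intro sum.cong) (auto simp: gh g that)
    also have "\<dots> = (A *\<^sub>v w) $ g i"
      using mult[OF w] g that by simp
    also have "\<dots> = b i"
      using Aw g that by simp
    finally show ?thesis .
  qed
  then show ?thesis
    by (intro exI[of _ "\<lambda>j. w $ g j"]) blast
qed

lemma dirichlet_form:
  fixes K :: "'i \<Rightarrow> 'i \<Rightarrow> real"
  assumes sym: "\<And>i j. i \<in> S \<Longrightarrow> j \<in> S \<Longrightarrow> K i j = K j i"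
  defines "D \<equiv> \<lambda>i. \<Sum>j\<in>S. K i j"
  shows "(\<Sum>i\<in>S. D i * (u i)\<^sup>2) - (\<Sum>i\<in>S. \<Sum>j\<in>S. K i j * u i * u j)
       = (\<Sum>i\<in>S. \<Sum>j\<in>S. K i j * (u i - u j)\<^sup>2) / 2"
proof -
  have 1: "(\<Sum>i\<in>S. \<Sum>j\<in>S. K i j * (u i)\<^sup>2) = (\<Sum>i\<in>S. D i * (u i)\<^sup>2)"
    by (simp add: D_def sum_distrib_right)
  have "(\<Sum>i\<in>S. \<Sum>j\<in>S. K i j * (u j)\<^sup>2) = (\<Sum>j\<in>S. \<Sum>i\<in>S. K i j * (u j)\<^sup>2)"
    by (rule sum.swap)
  also have "\<dots> = (\<Sum>j\<in>S. \<Sum>i\<in>S. K j i * (u j)\<^sup>2)"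
    by (intro sum.cong refl) (simp add: sym)
  finally have 2: "(\<Sum>i\<in>S. \<Sum>j\<in>S. K i j * (u j)\<^sup>2) = (\<Sum>i\<in>S. D i * (u i)\<^sup>2)"
    using 1 by simp
  have "(\<Sum>i\<in>S. \<Sum>j\<in>S. K i j * (u i - u j)\<^sup>2)
      = (\<Sum>i\<in>S. \<Sum>j\<in>S. K i j * (u i)\<^sup>2) + (\<Sum>i\<in>S. \<Sum>j\<in>S. K i j * (u j)\<^sup>2)
        - 2 * (\<Sum>i\<in>S. \<Sum>j\<in>S. K i j * u i * u j)"
    by (simp add: sum_distrib_left sum.distrib[symmetric] sum_subtractf[symmetric]
        power2_eq_square algebra_simps)
  then show ?thesis
    using 1 2 by simp
qed

text \<open>
  This is the spectral heart of the proof. With \<open>P = D\<inverse> K\<close>, a stochastic matrix that is self-adjoint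
  for \<open>\<langle>u, v\<rangle> = \<Sum> D\<^sub>i u\<^sub>i v\<^sub>i\<close>, the hypothesis \<open>gap\<close> reads \<open>\<langle>Pu, u\<rangle> \<le> \<langle>Pu, Pu\<rangle>\<close>, so it excludes
  eigenvalues of \<open>P\<close> strictly between 0 and 1. The eigenvalue 1 belongs to the constants only,
  because every index is linked to the hub \<open>h\<close>. Hence \<open>P\<close> is negative semidefinite on the
  orthogonal complement of the constants, and this is the conclusion.

  The spectral theorem can be avoided. Put \<open>L = 1 - P\<close>, which is positive semidefinite. Given \<open>y\<close>
  orthogonal to the constants, solve the Poisson equation \<open>L u = y\<close>. The hypothesis says
  \<open>\<langle>Lu, u\<rangle> \<le> \<langle>Lu, Lu\<rangle> = \<langle>y, y\<rangle>\<close>, and \<open>0 \<le> \<langle>L(u - y), u - y\<rangle> = \<langle>Lu, u\<rangle> - 2 \<langle>y, y\<rangle> + \<langle>Ly, y\<rangle>\<close>;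
  together they give \<open>\<langle>Ly, y\<rangle> \<ge> \<langle>y, y\<rangle>\<close>, that is \<open>\<langle>Py, y\<rangle> \<le> 0\<close>.
\<close>

lemma reverse_Cauchy_Schwarz_of_gap:
  fixes K :: "'i \<Rightarrow> 'i \<Rightarrow> real"
  assumes fin: "finite S"
    and sym: "\<And>i j. i \<in> S \<Longrightarrow> j \<in> S \<Longrightarrow> K i j = K j i"
    and nonneg: "\<And>i j. i \<in> S \<Longrightarrow> j \<in> S \<Longrightarrow> K i j \<ge> 0"
  defines "D \<equiv> \<lambda>i. \<Sum>j\<in>S. K i j"
  assumes pos: "\<And>i. i \<in> S \<Longrightarrow> D i > 0"
    and hub: "h \<in> S" "\<And>i. i \<in> S \<Longrightarrow> K i h > 0"
    and gap: "\<And>u. (\<Sum>i\<in>S. \<Sum>j\<in>S. K i j * u i * u j) \<le> (\<Sum>i\<in>S. (\<Sum>j\<in>S. K i j * u j)\<^sup>2 / D i)"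
  shows "(\<Sum>i\<in>S. \<Sum>j\<in>S. K i j * x i * x j) * (\<Sum>i\<in>S. D i) \<le> (\<Sum>i\<in>S. D i * x i)\<^sup>2"
proof -
  define Q where "Q u v = (\<Sum>i\<in>S. \<Sum>j\<in>S. K i j * u i * v j)" for u v
  define t where "t = (\<Sum>i\<in>S. D i)"
  have t: "t > 0"
    unfolding t_def using fin pos hub(1) by (intro sum_pos) auto
  define K1 where "K1 u i = (\<Sum>j\<in>S. K i j * u j)" for u i
  have Q_K1: "Q u v = (\<Sum>i\<in>S. u i * K1 v i)" for u v
    by (simp add: Q_def K1_def sum_distrib_left algebra_simps)
  have Q_sym: "Q u v = Q v u" for u v
    unfolding Q_def by (subst sum.swap) (intro sum.cong refl, simp add: sym)
  have sumK1: "(\<Sum>i\<in>S. K1 u i) = (\<Sum>i\<in>S. D i * u i)" for u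
    using Q_sym[of "\<lambda>_. 1" u]
    by (simp add: Q_K1) (simp add: K1_def D_def mult.commute)
  have dirichlet: "Q u u \<le> (\<Sum>i\<in>S. D i * (u i)\<^sup>2)" for u
  proof -
    have "0 \<le> (\<Sum>i\<in>S. \<Sum>j\<in>S. K i j * (u i - u j)\<^sup>2)"
      by (intro sum_nonneg mult_nonneg_nonneg nonneg) auto
    then show ?thesis
      using dirichlet_form[of S K u, OF sym] unfolding Q_def D_def by linarith
  qed
  \<comment> \<open>\<open>T\<close> is \<open>D\<close> times the sum of \<open>L\<close> and the orthogonal projection to the constants, hence invertible.\<close>
  define T where "T u i = D i * u i - K1 u i + D i * (\<Sum>j\<in>S. D j * u j) / t" for u i
  have sumT: "(\<Sum>i\<in>S. T u i) = (\<Sum>i\<in>S. D i * u i)" for u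
  proof -
    have "(\<Sum>i\<in>S. T u i) = (\<Sum>i\<in>S. D i * u i) - (\<Sum>i\<in>S. K1 u i)
        + (\<Sum>i\<in>S. D i) * ((\<Sum>j\<in>S. D j * u j) / t)"
      by (simp add: T_def sum.distrib sum_subtractf sum_distrib_right[symmetric]
          sum_divide_distrib[symmetric])
    then show ?thesis
      using t by (simp add: sumK1 t_def[symmetric])
  qed
  have inj: "\<forall>i\<in>S. u i = 0" if T0: "\<And>i. i \<in> S \<Longrightarrow> T u i = 0" for u
  proof -
    have mean: "(\<Sum>i\<in>S. D i * u i) = 0"
      using sumT[of u] T0 by simp
    then have "D i * u i = K1 u i" if "i \<in> S" for i
      using T0[OF that] by (simp add: T_def)
    then have "(\<Sum>i\<in>S. D i * (u i)\<^sup>2) = Q u u"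
      unfolding Q_K1 by (intro sum.cong) (auto simp: power2_eq_square algebra_simps)
    then have "(\<Sum>i\<in>S. \<Sum>j\<in>S. K i j * (u i - u j)\<^sup>2) = 0"
      using dirichlet_form[of S K u, OF sym] unfolding Q_def D_def by simp
    then have "K i h * (u i - u h)\<^sup>2 = 0" if "i \<in> S" for i
      using that hub(1) fin nonneg by (simp add: sum_nonneg_eq_0_iff sum_nonneg)
    then have const: "u i = u h" if "i \<in> S" for i
      using that hub(2)[OF that] by force
    then have "(\<Sum>i\<in>S. D i * u i) = t * u h"
      by (simp add: t_def sum_distrib_right)
    then show ?thesis
      using mean t const by simp
  qed
  define a where "a i j = (if i = j then D i else 0) - K i j + D i * D j / t" for i j
  have aT: "(\<Sum>j\<in>S. a i j * u j) = T u i" if "i \<in> S" for u i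
    using that fin
    by (simp add: a_def T_def K1_def algebra_simps sum.distrib sum_subtractf sum_distrib_left
        sum_divide_distrib if_distrib[of "\<lambda>x. _ * x"] cong: if_cong)
  \<comment> \<open>Only the component \<open>y\<close> of \<open>x\<close> orthogonal to the constants matters.\<close>
  define m where "m = (\<Sum>i\<in>S. D i * x i) / t"
  define y where "y i = x i - m" for i
  have Dy: "(\<Sum>i\<in>S. D i * y i) = 0"
  proof -
    have "(\<Sum>i\<in>S. D i * y i) = (\<Sum>i\<in>S. D i * x i) - m * t"
      by (simp add: y_def t_def right_diff_distrib sum_subtractf sum_distrib_left mult.commute)
    then show ?thesis
      using t by (simp add: m_def)
  qed
  obtain u where u: "\<And>i. i \<in> S \<Longrightarrow> T u i = D i * y i"
  proof -
    have "\<exists>u. \<forall>i\<in>S. (\<Sum>j\<in>S. a i j * u j) = D i * y i"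
      by (rule square_system_solvable[OF fin]) (use inj aT in auto)
    then show ?thesis
      using that aT by auto
  qed
  have "(\<Sum>i\<in>S. D i * u i) = 0"
    using sumT[of u] u Dy by simp
  then have Au: "K1 u i = D i * (u i - y i)" if "i \<in> S" for i
    using u[OF that] by (simp add: T_def algebra_simps)
  define n where "n v = (\<Sum>i\<in>S. D i * (v i)\<^sup>2)" for v
  have "Q u u \<le> (\<Sum>i\<in>S. (K1 u i)\<^sup>2 / D i)"
    using gap[of u] by (simp add: Q_def K1_def)
  also have "\<dots> = (\<Sum>i\<in>S. D i * (u i - y i)\<^sup>2)"
  proof (intro sum.cong refl)
    fix i assume i: "i \<in> S"
    show "(K1 u i)\<^sup>2 / D i = D i * (u i - y i)\<^sup>2"
      unfolding Au[OF i] using pos[OF i] by (simp add: power2_eq_square)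
  qed
  finally have gap_u: "Q u u \<le> n (\<lambda>i. u i - y i)"
    by (simp add: n_def)
  \<comment> \<open>By \<open>Au\<close>, the vector \<open>u - y\<close> is \<open>P u\<close>.\<close>
  have Quv: "Q v u = (\<Sum>i\<in>S. D i * v i * (u i - y i))" for v
    unfolding Q_K1 by (intro sum.cong) (auto simp: Au)
  have "Q (\<lambda>i. u i - y i) (\<lambda>i. u i - y i) = Q u u - 2 * Q y u + Q y y"
    using Q_sym[of u y]
    by (simp add: Q_def algebra_simps sum.distrib sum_subtractf)
  then have "Q u u - 2 * Q y u + Q y y \<le> n (\<lambda>i. u i - y i)"
    using dirichlet[of "\<lambda>i. u i - y i"] by (simp add: n_def)
  moreover have "Q u u = (\<Sum>i\<in>S. D i * u i * (u i - y i))" "Q y u = (\<Sum>i\<in>S. D i * y i * (u i - y i))"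
    by (rule Quv)+
  moreover have "n (\<lambda>i. u i - y i) = (\<Sum>i\<in>S. D i * u i * (u i - y i)) - (\<Sum>i\<in>S. D i * y i * (u i - y i))"
    unfolding n_def sum_subtractf[symmetric]
    by (intro sum.cong refl) (simp add: power2_eq_square algebra_simps)
  ultimately have Qy: "Q y y \<le> 0"
    using gap_u by linarith
  have "Q x x = Q (\<lambda>i. y i + m) (\<lambda>i. y i + m)"
    by (simp add: y_def)
  also have "\<dots> = Q y y + m * Q (\<lambda>_. 1) y + m * Q y (\<lambda>_. 1) + m\<^sup>2 * Q (\<lambda>_. 1) (\<lambda>_. 1)"
    by (simp add: Q_def algebra_simps sum.distrib sum_distrib_left power2_eq_square)
  also have "Q y (\<lambda>_. 1) = Q (\<lambda>_. 1) y"
    by (rule Q_sym)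
  also have "Q (\<lambda>_. 1) y = 0"
    by (simp add: Q_K1 sumK1 Dy)
  also have "Q (\<lambda>_. 1) (\<lambda>_. 1) = t"
    by (simp add: Q_def t_def D_def)
  finally have "Q x x * t \<le> m\<^sup>2 * t * t"
    using Qy t by simp
  also have "\<dots> = (\<Sum>i\<in>S. D i * x i)\<^sup>2"
    using t by (simp add: m_def power2_eq_square)
  finally show ?thesis
    by (simp add: Q_def t_def)
qed

text \<open>
  When \<open>M\<close> is symmetric and the form is positive at \<open>z\<close>, this expresses that \<open>M\<close> has exactly one
  positive eigenvalue: the form is negative semidefinite on the \<open>M\<close>-orthogonal complement of \<open>z\<close>.
\<close>

definition reverse_Cauchy_Schwarz :: "'i set \<Rightarrow> ('i \<Rightarrow> 'i \<Rightarrow> real) \<Rightarrow> ('i \<Rightarrow> real) \<Rightarrow> bool" where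
  "reverse_Cauchy_Schwarz A M z \<longleftrightarrow>
     (\<forall>x. (\<Sum>i\<in>A. \<Sum>j\<in>A. M i j * x i * x j) * (\<Sum>i\<in>A. \<Sum>j\<in>A. M i j * z i * z j)
          \<le> (\<Sum>i\<in>A. \<Sum>j\<in>A. M i j * x i * z j)\<^sup>2)"

text \<open>
  The substitution \<open>K\<^sub>i\<^sub>j = z\<^sub>i z\<^sub>j M\<^sub>i\<^sub>j\<close>, \<open>u\<^sub>i = x\<^sub>i / z\<^sub>i\<close> reduces this to the previous lemma, after
  removing the indices with \<open>d i = 0\<close>, whose rows and columns vanish.
\<close>

lemma reverse_Cauchy_Schwarz_of_weighted_gap:
  fixes M :: "'i \<Rightarrow> 'i \<Rightarrow> real"
  assumes fin: "finite A" and z: "\<And>i. i \<in> A \<Longrightarrow> z i > 0"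
    and sym: "\<And>i j. M i j = M j i"
    and nonneg: "\<And>i j. M i j \<ge> 0"
  defines "d \<equiv> \<lambda>i. \<Sum>j\<in>A. M i j * z j"
  assumes hub: "h \<in> A" "\<And>i. i \<in> A \<Longrightarrow> d i > 0 \<Longrightarrow> M i h > 0"
    and gap: "\<And>x. (\<Sum>i\<in>A. \<Sum>j\<in>A. M i j * x i * x j)
                   \<le> (\<Sum>i\<in>A. z i * ((\<Sum>j\<in>A. M i j * x j)\<^sup>2 / d i))"
  shows "reverse_Cauchy_Schwarz A M z"
  unfolding reverse_Cauchy_Schwarz_def
proof
  fix x :: "'i \<Rightarrow> real"
  define S where "S = {i \<in> A. d i > 0}"
  have S: "S \<subseteq> A" "finite S"
    using fin by (auto simp: S_def)
  have d_nonneg: "d i \<ge> 0" for i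
    unfolding d_def by (intro sum_nonneg mult_nonneg_nonneg nonneg) (use z less_imp_le in blast)
  have zero: "M i j = 0" if "i \<in> A" "j \<in> A" "i \<notin> S \<or> j \<notin> S" for i j
  proof -
    have row: "M i j = 0" if "i \<in> A" "j \<in> A" "i \<notin> S" for i j
    proof -
      have "d i = 0"
        using that d_nonneg[of i] by (auto simp: S_def)
      then have "M i j * z j = 0"
        unfolding d_def using fin that(2) z[THEN less_imp_le] nonneg
        by (subst (asm) sum_nonneg_eq_0_iff) (auto intro!: mult_nonneg_nonneg)
      then show ?thesis
        using z[OF that(2)] by simp
    qed
    show ?thesis
      using that row[of i j] row[of j i] sym[of i j] by auto
  qed
  have inner: "(\<Sum>j\<in>A. M i j * f j) = (\<Sum>j\<in>S. M i j * f j)" if "i \<in> A" for i f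
    by (rule sum.mono_neutral_right) (use fin S zero that in auto)
  have restrict: "(\<Sum>i\<in>A. \<Sum>j\<in>A. M i j * f i * g j) = (\<Sum>i\<in>S. \<Sum>j\<in>S. M i j * f i * g j)" for f g
  proof -
    have "(\<Sum>i\<in>A. \<Sum>j\<in>A. M i j * f i * g j) = (\<Sum>i\<in>A. \<Sum>j\<in>S. M i j * f i * g j)"
    proof (rule sum.cong[OF refl])
      fix i assume "i \<in> A"
      then show "(\<Sum>j\<in>A. M i j * f i * g j) = (\<Sum>j\<in>S. M i j * f i * g j)"
        using inner[of i "\<lambda>j. f i * g j"] by (simp add: mult.assoc)
    qed
    also have "\<dots> = (\<Sum>i\<in>S. \<Sum>j\<in>S. M i j * f i * g j)"
      by (rule sum.mono_neutral_right) (use fin S zero in \<open>auto intro!: sum.neutral\<close>)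
    finally show ?thesis .
  qed
  define K where "K i j = z i * z j * M i j" for i j
  have zS: "z i > 0" if "i \<in> S" for i
    using that S z by auto
  have z0: "z i \<noteq> 0" if "i \<in> S" for i
    using zS[OF that] by simp
  have K_row: "(\<Sum>j\<in>S. K i j) = z i * d i" if "i \<in> S" for i
  proof -
    have "(\<Sum>j\<in>S. K i j) = z i * (\<Sum>j\<in>S. M i j * z j)"
      by (simp add: K_def sum_distrib_left algebra_simps)
    then show ?thesis
      using that S inner[of i z] by (auto simp: d_def)
  qed
  have K_form: "(\<Sum>i\<in>S. \<Sum>j\<in>S. K i j * u i * v j)
      = (\<Sum>i\<in>A. \<Sum>j\<in>A. M i j * (z i * u i) * (z j * v j))" for u v
    unfolding restrict by (simp add: K_def algebra_simps)
  show "(\<Sum>i\<in>A. \<Sum>j\<in>A. M i j * x i * x j) * (\<Sum>i\<in>A. \<Sum>j\<in>A. M i j * z i * z j)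
      \<le> (\<Sum>i\<in>A. \<Sum>j\<in>A. M i j * x i * z j)\<^sup>2"
  proof (cases "S = {}")
    case True
    then show ?thesis
      unfolding restrict by simp
  next
    case False
    then obtain i where "i \<in> S"
      by blast
    then have "M h i > 0"
      using hub(2)[of i] sym[of i h] by (auto simp: S_def)
    then have "h \<in> S"
      using zero[of h i] hub(1) S \<open>i \<in> S\<close> by fastforce
    have "(\<Sum>i\<in>S. \<Sum>j\<in>S. K i j * (x i / z i) * (x j / z j)) * (\<Sum>i\<in>S. \<Sum>j\<in>S. K i j)
        \<le> (\<Sum>i\<in>S. (\<Sum>j\<in>S. K i j) * (x i / z i))\<^sup>2"
    proof (rule reverse_Cauchy_Schwarz_of_gap)
      show "K i j = K j i" for i j
        using sym[of i j] by (simp add: K_def)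
      show "K i j \<ge> 0" if "i \<in> S" "j \<in> S" for i j
        using zS[OF that(1)] zS[OF that(2)] nonneg[of i j] by (simp add: K_def)
      show "(\<Sum>j\<in>S. K i j) > 0" if "i \<in> S" for i
        using K_row[OF that] zS[OF that] that by (simp add: S_def)
      show "K i h > 0" if "i \<in> S" for i
        using that zS[OF that] zS[OF \<open>h \<in> S\<close>] hub(2)[of i] by (simp add: K_def S_def)
      fix u :: "'i \<Rightarrow> real"
      have "(\<Sum>i\<in>S. \<Sum>j\<in>S. K i j * u i * u j)
          \<le> (\<Sum>i\<in>A. z i * ((\<Sum>j\<in>A. M i j * (z j * u j))\<^sup>2 / d i))"
        unfolding K_form by (rule gap)
      also have "\<dots> = (\<Sum>i\<in>S. z i * ((\<Sum>j\<in>A. M i j * (z j * u j))\<^sup>2 / d i))"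
      proof (rule sum.mono_neutral_right)
        show "\<forall>i\<in>A - S. z i * ((\<Sum>j\<in>A. M i j * (z j * u j))\<^sup>2 / d i) = 0"
        proof
          fix i assume "i \<in> A - S"
          then have "d i = 0"
            using d_nonneg[of i] by (auto simp: S_def)
          then show "z i * ((\<Sum>j\<in>A. M i j * (z j * u j))\<^sup>2 / d i) = 0"
            by simp
        qed
      qed (use fin S in auto)
      also have "\<dots> = (\<Sum>i\<in>S. (\<Sum>j\<in>S. K i j * u j)\<^sup>2 / (\<Sum>j\<in>S. K i j))"
      proof (intro sum.cong refl)
        fix i assume i: "i \<in> S"
        have "(\<Sum>j\<in>S. K i j * u j) = z i * (\<Sum>j\<in>S. M i j * (z j * u j))"
          by (simp add: K_def sum_distrib_left algebra_simps)
        then have "(\<Sum>j\<in>S. K i j * u j) = z i * (\<Sum>j\<in>A. M i j * (z j * u j))"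
          using i S inner[of i "\<lambda>j. z j * u j"] by auto
        then show "z i * ((\<Sum>j\<in>A. M i j * (z j * u j))\<^sup>2 / d i)
            = (\<Sum>j\<in>S. K i j * u j)\<^sup>2 / (\<Sum>j\<in>S. K i j)"
          using zS[OF i] K_row[OF i] by (simp add: power2_eq_square)
      qed
      finally show "(\<Sum>i\<in>S. \<Sum>j\<in>S. K i j * u i * u j)
          \<le> (\<Sum>i\<in>S. (\<Sum>j\<in>S. K i j * u j)\<^sup>2 / (\<Sum>j\<in>S. K i j))" .
    qed (use S \<open>h \<in> S\<close> in auto)
    moreover have "(\<Sum>i\<in>S. \<Sum>j\<in>S. K i j * (x i / z i) * (x j / z j))
        = (\<Sum>i\<in>A. \<Sum>j\<in>A. M i j * x i * x j)"
      unfolding restrict by (intro sum.cong) (auto simp: K_def z0)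
    moreover have "(\<Sum>i\<in>S. \<Sum>j\<in>S. K i j) = (\<Sum>i\<in>A. \<Sum>j\<in>A. M i j * z i * z j)"
      using K_form[of "\<lambda>_. 1" "\<lambda>_. 1"] by simp
    moreover have "(\<Sum>i\<in>S. (\<Sum>j\<in>S. K i j) * (x i / z i)) = (\<Sum>i\<in>A. \<Sum>j\<in>A. M i j * x i * z j)"
      unfolding restrict sum_distrib_right by (intro sum.cong) (auto simp: K_def z0)
    ultimately show ?thesis
      by simp
  qed
qed

section \<open>From local to global signature of Hessians\<close>

text \<open>
  Let \<open>f\<close> be the homogeneous polynomial of degree \<open>size P + n\<close> whose partial derivatives of top
  order are the numbers \<open>\<phi> Q\<close>, where a multiset \<open>Q\<close> lists the variables of differentiation. Then
  \<open>ext_sum A z \<phi> n P\<close> is \<open>n!\<close> times the value at \<open>z\<close> of the derivative of \<open>f\<close> along \<open>P\<close>: it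
  sums over all ordered ways to extend \<open>P\<close> by \<open>n\<close> variables.
\<close>

primrec ext_sum :: "'i set \<Rightarrow> ('i \<Rightarrow> real) \<Rightarrow> ('i multiset \<Rightarrow> real) \<Rightarrow> nat \<Rightarrow> 'i multiset \<Rightarrow> real" where
  "ext_sum A z \<phi> 0 P = \<phi> P"
| "ext_sum A z \<phi> (Suc n) P = (\<Sum>i\<in>A. z i * ext_sum A z \<phi> n (add_mset i P))"

lemma ext_sum_nonneg:
  assumes "\<And>i. i \<in> A \<Longrightarrow> z i \<ge> 0" "\<And>P. \<phi> P \<ge> 0"
  shows "ext_sum A z \<phi> n P \<ge> 0"
  by (induction n arbitrary: P) (auto intro!: sum_nonneg mult_nonneg_nonneg assms)

lemma ext_sum_pos_imp_pos:
  assumes her: "\<And>i P. \<phi> (add_mset i P) > 0 \<Longrightarrow> \<phi> P > 0"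
    and z: "\<And>i. i \<in> A \<Longrightarrow> z i \<ge> 0"
    and "ext_sum A z \<phi> n P > 0"
  shows "\<phi> P > 0"
  using assms(3)
proof (induction n arbitrary: P)
  case (Suc n)
  obtain i where "i \<in> A" "z i * ext_sum A z \<phi> n (add_mset i P) > 0"
    using Suc.prems sum_nonpos[of A "\<lambda>i. z i * ext_sum A z \<phi> n (add_mset i P)"]
    by (force simp: not_less[symmetric])
  then have "ext_sum A z \<phi> n (add_mset i P) > 0"
    using z[of i] by (simp add: zero_less_mult_iff)
  then show ?case
    using Suc.IH her by blast
qed simp

lemma ext_sum_pos:
  assumes "finite A" "h \<in> A" and h: "\<And>P. \<phi> P > 0 \<Longrightarrow> \<phi> (add_mset h P) > 0"
    and z: "\<And>i. i \<in> A \<Longrightarrow> z i > 0" and nonneg: "\<And>P. \<phi> P \<ge> 0"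
    and "\<phi> P > 0"
  shows "ext_sum A z \<phi> n P > 0"
  using assms(6)
proof (induction n arbitrary: P)
  case (Suc n)
  have "0 < z h * ext_sum A z \<phi> n (add_mset h P)"
    using Suc.IH[OF h[OF Suc.prems]] z[OF assms(2)] by simp
  also have "\<dots> \<le> ext_sum A z \<phi> (Suc n) P"
    unfolding ext_sum.simps
    by (rule member_le_sum)
      (use assms(1,2) z[THEN less_imp_le] nonneg in \<open>auto intro!: mult_nonneg_nonneg ext_sum_nonneg\<close>)
  finally show ?case .
qed simp

text \<open>
  The local-to-global principle for Lorentzian polynomials: if the quadratic forms at
  the bottom of the recursion satisfy the reverse Cauchy-Schwarz inequality, then so does the
  Hessian of every derivative. By Euler's identity the Hessian is \<open>M = \<Sum>\<^sub>l z\<^sub>l N\<^sup>l\<close>, where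
  \<open>N\<^sup>l\<close> is the Hessian of the derivative along \<open>l\<close>, and again by Euler \<open>N\<^sup>l z\<close> is row \<open>l\<close> of
  \<open>M\<close>. The inductive inequality \<open>N\<^sup>l(x,x) \<le> (Mx)\<^sub>l\<^sup>2 / (Mz)\<^sub>l\<close>, summed over \<open>l\<close>, is the spectral
  gap hypothesis above. The variable \<open>h\<close>, which can always be appended, makes the
  connectedness condition trivial.
\<close>

theorem ext_sum_reverse_Cauchy_Schwarz:
  assumes fin: "finite A" and z: "\<And>i. i \<in> A \<Longrightarrow> z i > 0"
    and nonneg: "\<And>P. \<phi> P \<ge> 0"
    and her: "\<And>i P. \<phi> (add_mset i P) > 0 \<Longrightarrow> \<phi> P > 0"
    and h: "h \<in> A" "\<And>P. \<phi> P > 0 \<Longrightarrow> \<phi> (add_mset h P) > 0"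
    and base: "\<And>P. reverse_Cauchy_Schwarz A (\<lambda>i j. \<phi> (add_mset i (add_mset j P))) z"
  shows "reverse_Cauchy_Schwarz A (\<lambda>i j. ext_sum A z \<phi> n (add_mset i (add_mset j P))) z"
proof (induction n arbitrary: P)
  case 0
  then show ?case
    using base by simp
next
  case (Suc n)
  let ?F = "ext_sum A z \<phi>"
  define M where "M i j = ?F (Suc n) (add_mset i (add_mset j P))" for i j
  define N where "N l i j = ?F n (add_mset i (add_mset j (add_mset l P)))" for l i j
  have F_nonneg: "?F m R \<ge> 0" for m R
    using z nonneg by (intro ext_sum_nonneg) (auto intro: less_imp_le)
  have M_N: "M i j = (\<Sum>l\<in>A. z l * N l i j)" for i j
    by (simp add: M_def N_def add_mset_commute)
  have N_row: "(\<Sum>j\<in>A. N l i j * z j) = M l i" for l i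
    by (simp add: M_def N_def add_mset_commute mult.commute)
  have "reverse_Cauchy_Schwarz A M z"
  proof (rule reverse_Cauchy_Schwarz_of_weighted_gap[where h = h])
    show "M i j = M j i" for i j
      by (simp add: M_def add_mset_commute)
    show "M i j \<ge> 0" for i j
      unfolding M_def by (rule F_nonneg)
    show "M i h > 0" if "i \<in> A" "(\<Sum>j\<in>A. M i j * z j) > 0" for i
    proof -
      have "(\<Sum>j\<in>A. M i j * z j) = ?F (Suc (Suc n)) (add_mset i P)"
        by (simp add: M_def add_mset_commute mult.commute)
      then have "?F (Suc (Suc n)) (add_mset i P) > 0"
        using that(2) by linarith
      then have "\<phi> (add_mset i P) > 0"
        by (rule ext_sum_pos_imp_pos[of \<phi>, rotated 2]) (fact her, rule less_imp_le[OF z])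
      then have "\<phi> (add_mset i (add_mset h P)) > 0"
        using h(2) by (metis add_mset_commute)
      then show ?thesis
        unfolding M_def by (intro ext_sum_pos[of A h \<phi> z] fin h z nonneg)
    qed
    fix x :: "'a \<Rightarrow> real"
    define d where "d l = (\<Sum>j\<in>A. M l j * z j)" for l
    have "(\<Sum>i\<in>A. \<Sum>j\<in>A. M i j * x i * x j)
        = (\<Sum>i\<in>A. \<Sum>j\<in>A. \<Sum>l\<in>A. z l * (N l i j * x i * x j))"
      by (simp add: M_N sum_distrib_right mult.assoc)
    also have "\<dots> = (\<Sum>i\<in>A. \<Sum>l\<in>A. \<Sum>j\<in>A. z l * (N l i j * x i * x j))"
      by (intro sum.cong refl sum.swap)
    also have "\<dots> = (\<Sum>l\<in>A. \<Sum>i\<in>A. \<Sum>j\<in>A. z l * (N l i j * x i * x j))"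
      by (rule sum.swap)
    also have "\<dots> = (\<Sum>l\<in>A. z l * (\<Sum>i\<in>A. \<Sum>j\<in>A. N l i j * x i * x j))"
      by (simp add: sum_distrib_left)
    also have "\<dots> \<le> (\<Sum>l\<in>A. z l * ((\<Sum>i\<in>A. M l i * x i)\<^sup>2 / d l))"
    proof (intro sum_mono mult_left_mono)
      fix l assume l: "l \<in> A"
      have zz: "(\<Sum>i\<in>A. \<Sum>j\<in>A. N l i j * z i * z j) = d l"
        unfolding d_def N_row[symmetric] by (simp add: sum_distrib_left sum_distrib_right algebra_simps)
      have xz: "(\<Sum>i\<in>A. \<Sum>j\<in>A. N l i j * x i * z j) = (\<Sum>i\<in>A. M l i * x i)"
        unfolding N_row[symmetric] by (simp add: sum_distrib_left sum_distrib_right algebra_simps)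
      have IH: "(\<Sum>i\<in>A. \<Sum>j\<in>A. N l i j * x i * x j) * d l \<le> (\<Sum>i\<in>A. M l i * x i)\<^sup>2"
      proof -
        have "reverse_Cauchy_Schwarz A (N l) z"
          using Suc.IH[of "add_mset l P"] by (simp add: N_def[abs_def])
        from this[unfolded reverse_Cauchy_Schwarz_def, rule_format, of x] show ?thesis
          unfolding zz xz .
      qed
      have N_nonneg: "N l i j \<ge> 0" for i j
        unfolding N_def by (rule F_nonneg)
      have d_nonneg: "d l \<ge> 0"
        unfolding zz[symmetric]
        by (intro sum_nonneg mult_nonneg_nonneg N_nonneg) (use z less_imp_le in blast)+
      show "(\<Sum>i\<in>A. \<Sum>j\<in>A. N l i j * x i * x j) \<le> (\<Sum>i\<in>A. M l i * x i)\<^sup>2 / d l"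
      proof (cases "d l = 0")
        case True
        have "N l i j = 0" if "i \<in> A" "j \<in> A" for i j
        proof -
          have "N l i j * z i * z j \<le> (\<Sum>j\<in>A. N l i j * z i * z j)"
            by (rule member_le_sum) (use that fin z[THEN less_imp_le] N_nonneg in auto)
          also have "\<dots> \<le> (\<Sum>i\<in>A. \<Sum>j\<in>A. N l i j * z i * z j)"
            by (rule member_le_sum[where f = "\<lambda>i. \<Sum>j\<in>A. N l i j * z i * z j"])
              (use that fin z[THEN less_imp_le] N_nonneg in \<open>auto intro!: sum_nonneg\<close>)
          finally have "N l i j * (z i * z j) \<le> 0"
            using zz True by (simp add: mult.assoc)
          moreover have "z i * z j > 0"
            using z that by simp
          ultimately show ?thesis
            using N_nonneg[of i j] by (smt (verit) mult_pos_pos)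
        qed
        then show ?thesis
          using True by simp
      next
        case False
        then show ?thesis
          using IH d_nonneg by (simp add: field_simps)
      qed
    qed (use z less_imp_le in blast)
    finally show "(\<Sum>i\<in>A. \<Sum>j\<in>A. M i j * x i * x j)
        \<le> (\<Sum>i\<in>A. z i * ((\<Sum>j\<in>A. M i j * x j)\<^sup>2 / (\<Sum>j\<in>A. M i j * z j)))"
      by (simp add: d_def)
  qed (use fin z h in auto)
  then show ?case
    by (simp add: M_def[abs_def])
qed

section \<open>Matrices of rank one minus a block form\<close>

text \<open>
  A rank-one form minus a positive semidefinite one is nonpositive on the kernel of the linear form
  \<open>c\<close>. If the form \<open>B\<close> of \<open>M\<close> is positive at \<open>z\<close>, some \<open>x - t z\<close> lies in this kernel. So the
  quadratic polynomial \<open>B(x - t z, x - t z)\<close> in \<open>t\<close>, with leading coefficient \<open>B(z, z) > 0\<close>, takes a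
  value that is not positive, and its discriminant is nonnegative.
\<close>

lemma reverse_Cauchy_Schwarz_of_rank_one_minus_psd:
  fixes M :: "'i \<Rightarrow> 'i \<Rightarrow> real"
  assumes M: "\<And>i j. i \<in> A \<Longrightarrow> j \<in> A \<Longrightarrow> M i j = c i * c j - r i j"
    and sym: "\<And>i j. M i j = M j i"
    and psd: "\<And>x. (\<Sum>i\<in>A. \<Sum>j\<in>A. r i j * x i * x j) \<ge> 0"
    and zz: "(\<Sum>i\<in>A. \<Sum>j\<in>A. M i j * z i * z j) \<ge> 0"
  shows "reverse_Cauchy_Schwarz A M z"
  unfolding reverse_Cauchy_Schwarz_def
proof
  fix x :: "'i \<Rightarrow> real"
  define B where "B u v = (\<Sum>i\<in>A. \<Sum>j\<in>A. M i j * u i * v j)" for u v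
  define s where "s u = (\<Sum>i\<in>A. c i * u i)" for u
  have B_le: "B u u \<le> (s u)\<^sup>2" for u
  proof -
    have "B u u = (\<Sum>i\<in>A. \<Sum>j\<in>A. (c i * u i) * (c j * u j) - r i j * u i * u j)"
      unfolding B_def by (intro sum.cong refl) (simp add: M algebra_simps)
    also have "\<dots> = (s u)\<^sup>2 - (\<Sum>i\<in>A. \<Sum>j\<in>A. r i j * u i * u j)"
      by (simp add: sum_subtractf s_def power2_eq_square sum_product)
    finally show ?thesis
      using psd[of u] by linarith
  qed
  have B_sym: "B u v = B v u" for u v
    unfolding B_def by (subst sum.swap) (intro sum.cong refl, simp add: sym)
  have "B x x * B z z \<le> (B x z)\<^sup>2"
  proof (cases "B z z = 0")
    case False
    then have pos: "B z z > 0"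
      using zz by (simp add: B_def)
    then have "s z \<noteq> 0"
      using B_le[of z] by auto
    define t where "t = s x / s z"
    have "s (\<lambda>i. x i - t * z i) = s x - t * s z"
      by (simp add: s_def algebra_simps sum_subtractf sum_distrib_left)
    then have "s (\<lambda>i. x i - t * z i) = 0"
      using \<open>s z \<noteq> 0\<close> by (simp add: t_def)
    then have "B (\<lambda>i. x i - t * z i) (\<lambda>i. x i - t * z i) \<le> 0"
      using B_le[of "\<lambda>i. x i - t * z i"] by simp
    also have "B (\<lambda>i. x i - t * z i) (\<lambda>i. x i - t * z i)
        = B x x - t * B x z - t * B z x + t\<^sup>2 * B z z"
      by (simp add: B_def algebra_simps power2_eq_square sum.distrib sum_subtractf sum_distrib_left)
    finally have "B x x * B z z \<le> (2 * t * B x z - t\<^sup>2 * B z z) * B z z"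
      using pos B_sym[of z x] by (intro mult_right_mono) auto
    also have "\<dots> = (B x z)\<^sup>2 - (B x z - t * B z z)\<^sup>2"
      by (simp add: power2_eq_square algebra_simps)
    finally show ?thesis
      using zero_le_power2[of "B x z - t * B z z"] by linarith
  qed simp
  then show "(\<Sum>i\<in>A. \<Sum>j\<in>A. M i j * x i * x j) * (\<Sum>i\<in>A. \<Sum>j\<in>A. M i j * z i * z j)
      \<le> (\<Sum>i\<in>A. \<Sum>j\<in>A. M i j * x i * z j)\<^sup>2"
    by (simp add: B_def)
qed

lemma block_form_nonneg:
  fixes x :: "'i \<Rightarrow> real"
  assumes "finite V"
  shows "(\<Sum>e\<in>V. \<Sum>f\<in>V. (if \<kappa> e = \<kappa> f then x e * x f else 0)) \<ge> 0"
proof -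
  have "(\<Sum>e\<in>V. \<Sum>f\<in>V. (if \<kappa> e = \<kappa> f then x e * x f else 0))
      = (\<Sum>e\<in>V. x e * (\<Sum>f | f \<in> V \<and> \<kappa> f = \<kappa> e. x f))"
    using assms by (intro sum.cong refl)
      (auto simp: sum_distrib_left sum.inter_filter intro!: sum.cong)
  also have "\<dots> = (\<Sum>k\<in>\<kappa> ` V. \<Sum>e | e \<in> V \<and> \<kappa> e = k. x e * (\<Sum>f | f \<in> V \<and> \<kappa> f = \<kappa> e. x f))"
    using assms by (rule sum.image_gen)
  also have "\<dots> = (\<Sum>k\<in>\<kappa> ` V. (\<Sum>e | e \<in> V \<and> \<kappa> e = k. x e)\<^sup>2)"
    by (intro sum.cong refl) (simp add: power2_eq_square sum_distrib_right)
  also have "\<dots> \<ge> 0"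
    by (intro sum_nonneg) simp
  finally show ?thesis .
qed

section \<open>Independent sets of a matroid by size\<close>

text \<open>
  Matroids, presented by the property of independent sets that the base case needs: after
  contracting an independent set \<open>S\<close>, being parallel is an equivalence relation on the remaining
  non-loops. It is given by the fibres of a map \<open>\<kappa> S\<close>; for a graph this will be the pair of
  components of \<open>S\<close> that an edge joins.
\<close>

locale matroid_with_parallel_classes =
  fixes E :: "'e set" and I :: "'e set set" and \<kappa> :: "'e set \<Rightarrow> 'e \<Rightarrow> 'k"
  assumes finite_ground: "finite E"
    and indep_subset: "S \<in> I \<Longrightarrow> S \<subseteq> E"
    and empty_indep: "{} \<in> I"
    and hereditary: "T \<in> I \<Longrightarrow> S \<subseteq> T \<Longrightarrow> S \<in> I"
    and parallel: "\<lbrakk>e \<in> E; e \<notin> S; insert e S \<in> I; f \<in> E; f \<notin> S; insert f S \<in> I; e \<noteq> f\<rbrakk>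
       \<Longrightarrow> insert e (insert f S) \<in> I \<longleftrightarrow> \<kappa> S e \<noteq> \<kappa> S f"
begin

lemma finite_indep: "finite I"
  by (rule finite_subset[of _ "Pow E"]) (use finite_ground indep_subset in auto)

text \<open>
  The polynomial of degree \<open>d\<close> under study is \<open>\<Sum>\<^sub>T y\<^bsup>d - |T|\<^esup> / (d - |T|)! \<Prod>\<^sub>e\<^sub>\<in>\<^sub>T z\<^sub>e\<close>, the sum over
  independent sets \<open>T\<close> of size at most \<open>d\<close>. The index \<open>Some e\<close> stands for \<open>z\<^sub>e\<close> and \<open>None\<close> for the
  extra variable \<open>y\<close>. A top-order derivative is 1 if the elements differentiated by are distinct
  and independent, no matter how often \<open>y\<close> occurs, and 0 otherwise.
\<close>

definition elts :: "'e option multiset \<Rightarrow> 'e set" where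
  "elts P = {e. Some e \<in># P}"

definition valid :: "'e option multiset \<Rightarrow> bool" where
  "valid P \<longleftrightarrow> (\<forall>e. count P (Some e) \<le> 1) \<and> elts P \<in> I"

definition \<chi> :: "'e option multiset \<Rightarrow> real" where
  "\<chi> P = of_bool (valid P)"

lemma elts_add [simp]:
  "elts (add_mset None P) = elts P" "elts (add_mset (Some e) P) = insert e (elts P)"
  by (auto simp: elts_def)

lemma valid_add_None [simp]: "valid (add_mset None P) \<longleftrightarrow> valid P"
  by (simp add: valid_def)

lemma valid_add_Some [simp]:
  "valid (add_mset (Some e) P) \<longleftrightarrow> valid P \<and> e \<notin> elts P \<and> insert e (elts P) \<in> I"
proof (cases "e \<in> elts P")
  case True
  then have "\<not> count (add_mset (Some e) P) (Some e) \<le> 1"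
    by (simp add: elts_def)
  then have "\<not> valid (add_mset (Some e) P)"
    unfolding valid_def by blast
  then show ?thesis
    using True by simp
next
  case False
  then have "count P (Some e) = 0"
    by (simp add: elts_def not_in_iff)
  then have "count (add_mset (Some e) P) (Some f) \<le> 1 \<longleftrightarrow> count P (Some f) \<le> 1" for f
    by (cases "f = e") simp_all
  moreover have "insert e (elts P) \<in> I \<Longrightarrow> elts P \<in> I"
    using hereditary by blast
  ultimately show ?thesis
    using False unfolding valid_def elts_add by blast
qed

lemma valid_empty: "valid {#}"
  by (simp add: valid_def elts_def empty_indep)

lemma \<chi>_add_pos: "\<chi> (add_mset i P) > 0 \<Longrightarrow> \<chi> P > 0"
  by (cases i) (auto simp: \<chi>_def)

abbreviation "ground \<equiv> insert None (Some ` E)"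

lemma sum_ground: "(\<Sum>i\<in>ground. g i) = g None + (\<Sum>e\<in>E. g (Some e))" for g :: "'e option \<Rightarrow> real"
  using finite_ground by (subst sum.insert) (auto simp: sum.reindex)

text \<open>
  The base case. After contracting \<open>S\<close>, two non-loops extend \<open>S\<close> together exactly if they are not
  parallel, and \<open>y\<close> goes with everything. So the quadratic form is
  \<open>(x\<^sub>y + \<Sum>\<^sub>e x\<^sub>e)\<^sup>2 - \<Sum>\<^sub>C (\<Sum>\<^sub>e\<^sub>\<in>\<^sub>C x\<^sub>e)\<^sup>2\<close>, where \<open>C\<close> runs over the parallel classes.
\<close>

lemma \<chi>_reverse_Cauchy_Schwarz:
  assumes z: "\<And>i. i \<in> ground \<Longrightarrow> z i \<ge> 0"
  shows "reverse_Cauchy_Schwarz ground (\<lambda>i j. \<chi> (add_mset i (add_mset j P))) z"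
proof (cases "valid P")
  case False
  then have "\<chi> (add_mset i (add_mset j P)) = 0" for i j
    by (cases i; cases j) (auto simp: \<chi>_def)
  then show ?thesis
    by (simp add: reverse_Cauchy_Schwarz_def)
next
  case True
  define S where "S = elts P"
  define V where "V = {e \<in> E. e \<notin> S \<and> insert e S \<in> I}"
  define c :: "'e option \<Rightarrow> real" where
    "c i = (case i of None \<Rightarrow> 1 | Some e \<Rightarrow> of_bool (e \<in> V))" for i
  define r :: "'e option \<Rightarrow> 'e option \<Rightarrow> real" where
    "r i j = (case (i, j) of (Some e, Some f) \<Rightarrow> of_bool (e \<in> V \<and> f \<in> V \<and> \<kappa> S e = \<kappa> S f) | _ \<Rightarrow> 0)"
    for i j
  show ?thesis
  proof (rule reverse_Cauchy_Schwarz_of_rank_one_minus_psd)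
    fix i j assume ij: "i \<in> ground" "j \<in> ground"
    show "\<chi> (add_mset i (add_mset j P)) = c i * c j - r i j"
    proof (cases i; cases j)
      fix e f assume ef: "i = Some e" "j = Some f"
      then have E: "e \<in> E" "f \<in> E"
        using ij by auto
      have "valid (add_mset i (add_mset j P)) \<longleftrightarrow> e \<in> V \<and> f \<in> V \<and> \<kappa> S e \<noteq> \<kappa> S f"
      proof
        assume v: "valid (add_mset i (add_mset j P))"
        then have v': "e \<noteq> f" "e \<notin> S" "f \<notin> S" "insert e (insert f S) \<in> I"
          by (auto simp: ef S_def)
        then have "insert e S \<in> I" "insert f S \<in> I"
          using hereditary by blast+
        then show "e \<in> V \<and> f \<in> V \<and> \<kappa> S e \<noteq> \<kappa> S f"
          using parallel[of e S f] v' E by (auto simp: V_def)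
      next
        assume "e \<in> V \<and> f \<in> V \<and> \<kappa> S e \<noteq> \<kappa> S f"
        then show "valid (add_mset i (add_mset j P))"
          using parallel[of e S f] True by (auto simp: ef V_def S_def)
      qed
      then show ?thesis
        by (auto simp: \<chi>_def c_def r_def ef)
    qed (use ij True in \<open>auto simp: \<chi>_def c_def r_def V_def S_def\<close>)
  next
    fix x :: "'e option \<Rightarrow> real"
    have V: "V \<subseteq> E" "finite V"
      using finite_ground by (auto simp: V_def)
    have "(\<Sum>i\<in>ground. \<Sum>j\<in>ground. r i j * x i * x j)
        = (\<Sum>e\<in>E. \<Sum>f\<in>E. r (Some e) (Some f) * x (Some e) * x (Some f))"
      unfolding sum_ground by (simp add: r_def)
    also have "\<dots> = (\<Sum>e\<in>E. \<Sum>f\<in>V. r (Some e) (Some f) * x (Some e) * x (Some f))"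
      by (intro sum.cong refl sum.mono_neutral_right) (use V finite_ground in \<open>auto simp: r_def\<close>)
    also have "\<dots> = (\<Sum>e\<in>V. \<Sum>f\<in>V. r (Some e) (Some f) * x (Some e) * x (Some f))"
      by (intro sum.mono_neutral_right) (use V finite_ground in \<open>auto simp: r_def\<close>)
    also have "\<dots> = (\<Sum>e\<in>V. \<Sum>f\<in>V. (if \<kappa> S e = \<kappa> S f then x (Some e) * x (Some f) else 0))"
      by (intro sum.cong refl) (auto simp: r_def)
    also have "\<dots> \<ge> 0"
      by (rule block_form_nonneg[OF V(2)])
    finally show "(\<Sum>i\<in>ground. \<Sum>j\<in>ground. r i j * x i * x j) \<ge> 0" .
  next
    show "(\<Sum>i\<in>ground. \<Sum>j\<in>ground. \<chi> (add_mset i (add_mset j P)) * z i * z j) \<ge> 0"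
      by (intro sum_nonneg mult_nonneg_nonneg z) (auto simp: \<chi>_def)
  qed (simp add: add_mset_commute)
qed

text \<open>
  The point at which derivatives are evaluated has \<open>y = \<epsilon>\<close>. The local-to-global principle needs
  \<open>\<epsilon> > 0\<close>, whereas at \<open>\<epsilon> = 0\<close> only independent sets of a single size are counted; continuity
  links the two.
\<close>

abbreviation weight :: "real \<Rightarrow> 'e option \<Rightarrow> real" where
  "weight \<epsilon> \<equiv> case_option \<epsilon> (\<lambda>_. 1)"

abbreviation "ext \<epsilon> \<equiv> ext_sum ground (weight \<epsilon>) \<chi>"

text \<open>
  The reverse Cauchy-Schwarz inequality at the unit vector of \<open>y\<close>; by Euler's identity the two
  factors involving \<open>z\<close> are lower-order derivatives.
\<close>

lemma ext_log_concave:
  assumes "\<epsilon> > 0"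
  shows "ext \<epsilon> n {#None, None#} * ext \<epsilon> (Suc (Suc n)) {#} \<le> (ext \<epsilon> (Suc n) {#None#})\<^sup>2"
proof -
  define M where "M i j = ext \<epsilon> n {#i, j#}" for i j
  define u :: "'e option \<Rightarrow> real" where "u i = of_bool (i = None)" for i
  have "reverse_Cauchy_Schwarz ground M (weight \<epsilon>)"
    unfolding M_def
    by (rule ext_sum_reverse_Cauchy_Schwarz[where h = None])
      (use assms finite_ground in \<open>auto simp: \<chi>_add_pos split: option.splits
         intro!: \<chi>_reverse_Cauchy_Schwarz, auto simp: \<chi>_def\<close>)
  then have "(\<Sum>i\<in>ground. \<Sum>j\<in>ground. M i j * u i * u j)
      * (\<Sum>i\<in>ground. \<Sum>j\<in>ground. M i j * weight \<epsilon> i * weight \<epsilon> j)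
      \<le> (\<Sum>i\<in>ground. \<Sum>j\<in>ground. M i j * u i * weight \<epsilon> j)\<^sup>2"
    unfolding reverse_Cauchy_Schwarz_def by blast
  moreover have "(\<Sum>i\<in>ground. \<Sum>j\<in>ground. M i j * u i * u j) = ext \<epsilon> n {#None, None#}"
    unfolding sum_ground by (simp add: u_def M_def)
  moreover have "(\<Sum>i\<in>ground. \<Sum>j\<in>ground. M i j * weight \<epsilon> i * weight \<epsilon> j) = ext \<epsilon> (Suc (Suc n)) {#}"
    by (simp only: ext_sum.simps sum_distrib_left M_def)
      (simp add: add_mset_commute algebra_simps)
  moreover have "(\<Sum>i\<in>ground. \<Sum>j\<in>ground. M i j * u i * weight \<epsilon> j) = ext \<epsilon> (Suc n) {#None#}"
    unfolding sum_ground ext_sum.simps by (simp add: u_def M_def add_mset_commute)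
  ultimately show ?thesis
    by simp
qed

lemma ext_tendsto: "((\<lambda>\<epsilon>. ext \<epsilon> n P) \<longlongrightarrow> ext 0 n P) (at_right 0)"
proof (induction n arbitrary: P)
  case (Suc n)
  have "((\<lambda>\<epsilon>. weight \<epsilon> i) \<longlongrightarrow> weight 0 i) (at_right 0)" for i
    by (cases i) auto
  then show ?case
    unfolding ext_sum.simps by (intro tendsto_sum tendsto_mult Suc.IH)
qed simp

text \<open>
  Each set \<open>T\<close> of the right size is reached through the \<open>n!\<close> orderings of \<open>T - elts P\<close>; the
  induction counts pairs of a set \<open>T\<close> and the element of \<open>T - elts P\<close> added first.
\<close>

lemma ext_0_eq:
  assumes "valid P"
  shows "ext 0 n P = fact n * card {T \<in> I. elts P \<subseteq> T \<and> card T = card (elts P) + n}"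
  using assms
proof (induction n arbitrary: P)
  case 0
  have "T = elts P" if "T \<in> I" "elts P \<subseteq> T" "card T = card (elts P)" for T
    using that card_subset_eq[of T "elts P"] indep_subset finite_ground finite_subset by metis
  then have "{T \<in> I. elts P \<subseteq> T \<and> card T = card (elts P) + 0} = {elts P}"
    using 0 by (auto simp: valid_def)
  then show ?case
    using 0 by (simp add: \<chi>_def)
next
  case (Suc n)
  define S where "S = elts P"
  define V where "V = {e \<in> E. e \<notin> S \<and> insert e S \<in> I}"
  define X where "X = {T \<in> I. S \<subseteq> T \<and> card T = card S + Suc n}"
  have fin: "finite T" if "T \<in> I" for T
    using that indep_subset finite_ground finite_subset by metis
  have S: "S \<in> I" "finite S"
    using Suc.prems fin by (auto simp: valid_def S_def)
  have "ext 0 (Suc n) P = (\<Sum>e\<in>E. ext 0 n (add_mset (Some e) P))"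
    unfolding ext_sum.simps sum_ground by simp
  also have "\<dots> = (\<Sum>e\<in>V. ext 0 n (add_mset (Some e) P))"
  proof (rule sum.mono_neutral_right)
    show "\<forall>e\<in>E - V. ext 0 n (add_mset (Some e) P) = 0"
    proof
      fix e assume "e \<in> E - V"
      then have "\<not> \<chi> (add_mset (Some e) P) > 0"
        by (auto simp: \<chi>_def V_def S_def)
      then have "\<not> ext 0 n (add_mset (Some e) P) > 0"
        using ext_sum_pos_imp_pos[where \<phi> = \<chi> and A = ground and z = "weight 0", OF \<chi>_add_pos]
        by (auto split: option.splits)
      moreover have "ext 0 n (add_mset (Some e) P) \<ge> 0"
        by (rule ext_sum_nonneg) (auto simp: \<chi>_def split: option.splits)
      ultimately show "ext 0 n (add_mset (Some e) P) = 0"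
        by linarith
    qed
  qed (use finite_ground in \<open>auto simp: V_def\<close>)
  also have "\<dots> = (\<Sum>e\<in>V. fact n * real (card {T \<in> X. e \<in> T}))"
  proof (intro sum.cong refl)
    fix e assume e: "e \<in> V"
    then have v: "valid (add_mset (Some e) P)"
      using Suc.prems by (auto simp: V_def S_def)
    have "{T \<in> I. insert e S \<subseteq> T \<and> card T = card (insert e S) + n} = {T \<in> X. e \<in> T}"
      using e S by (auto simp: X_def V_def)
    then show "ext 0 n (add_mset (Some e) P) = fact n * real (card {T \<in> X. e \<in> T})"
      using Suc.IH[OF v] by (simp add: S_def)
  qed
  also have "\<dots> = fact n * real (\<Sum>e\<in>V. card {T \<in> X. e \<in> T})"
    by (simp add: sum_distrib_left)
  also have "(\<Sum>e\<in>V. card {T \<in> X. e \<in> T}) = Suc n * card X"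
  proof (rule sum_multicount)
    show "\<forall>T\<in>X. card {e \<in> V. e \<in> T} = Suc n"
    proof
      fix T assume T: "T \<in> X"
      have "insert e S \<in> I" if "e \<in> T" for e
        using T that hereditary[of T "insert e S"] by (auto simp: X_def)
      then have "{e \<in> V. e \<in> T} = T - S"
        using T indep_subset by (auto simp: V_def X_def)
      then show "card {e \<in> V. e \<in> T} = Suc n"
        using T S by (simp add: X_def card_Diff_subset)
    qed
  qed (use finite_ground finite_indep in \<open>auto simp: V_def X_def\<close>)
  finally show ?case
    by (simp add: X_def S_def algebra_simps)
qed

definition count_indep :: "nat \<Rightarrow> real" where
  "count_indep k = card {T \<in> I. card T = k}"

lemma ext_0_None:
  "ext 0 n {#} = fact n * count_indep n" "ext 0 n {#None#} = fact n * count_indep n"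
  "ext 0 n {#None, None#} = fact n * count_indep n"
  by (subst ext_0_eq; simp add: valid_empty count_indep_def; simp add: elts_def)+

text \<open>
  In terms of the numbers \<open>I\<^sub>k\<close> of independent sets of size \<open>k\<close> this is Mason's inequality
  \<open>I\<^sub>k\<^sup>2 \<ge> (1 + 1/k) I\<^sub>k\<^sub>-\<^sub>1 I\<^sub>k\<^sub>+\<^sub>1\<close>.
\<close>

theorem count_indep_Mason:
  "(fact n * count_indep n) * (fact (Suc (Suc n)) * count_indep (Suc (Suc n)))
     \<le> (fact (Suc n) * count_indep (Suc n))\<^sup>2"
proof -
  have "ext 0 n {#None, None#} * ext 0 (Suc (Suc n)) {#} \<le> (ext 0 (Suc n) {#None#})\<^sup>2"
  proof (rule tendsto_le[of "at_right 0"])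
    show "\<forall>\<^sub>F \<epsilon> in at_right 0.
        ext \<epsilon> n {#None, None#} * ext \<epsilon> (Suc (Suc n)) {#} \<le> (ext \<epsilon> (Suc n) {#None#})\<^sup>2"
      using eventually_at_right_less[of "0::real"] by eventually_elim (rule ext_log_concave)
  qed (intro tendsto_mult tendsto_power ext_tendsto | simp)+
  then show ?thesis
    by (simp only: ext_0_None)
qed

lemma count_indep_nonneg: "count_indep k \<ge> 0"
  by (simp add: count_indep_def)

lemma count_indep_pos_Suc: "count_indep (Suc k) > 0 \<Longrightarrow> count_indep k > 0"
proof -
  assume "count_indep (Suc k) > 0"
  then obtain T where T: "T \<in> I" "card T = Suc k"
    by (auto simp: count_indep_def card_gt_0_iff)
  then obtain e where "e \<in> T"
    by fastforce
  then have "T - {e} \<in> {T \<in> I. card T = k}"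
    using T hereditary[of T "T - {e}"] by auto
  then show "count_indep k > 0"
    using finite_indep by (auto simp: count_indep_def card_gt_0_iff)
qed

lemma count_indep_log_concave: "count_indep n * count_indep (Suc (Suc n)) \<le> (count_indep (Suc n))\<^sup>2"
proof -
  define f where "f = (fact n :: real)"
  have f: "f > 0"
    by (simp add: f_def)
  have "f\<^sup>2 * (real (Suc n) * real (Suc (Suc n)) * (count_indep n * count_indep (Suc (Suc n))))
      \<le> f\<^sup>2 * ((real (Suc n))\<^sup>2 * (count_indep (Suc n))\<^sup>2)"
    using count_indep_Mason[of n] by (simp add: f_def power2_eq_square algebra_simps)
  then have "real (Suc n) * real (Suc (Suc n)) * (count_indep n * count_indep (Suc (Suc n)))
      \<le> (real (Suc n))\<^sup>2 * (count_indep (Suc n))\<^sup>2"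
    using f by simp
  moreover have "(real (Suc n))\<^sup>2 * (count_indep n * count_indep (Suc (Suc n)))
      \<le> real (Suc n) * real (Suc (Suc n)) * (count_indep n * count_indep (Suc (Suc n)))"
    by (intro mult_right_mono) (auto simp: power2_eq_square count_indep_nonneg)
  ultimately have "(real (Suc n))\<^sup>2 * (count_indep n * count_indep (Suc (Suc n)))
      \<le> (real (Suc n))\<^sup>2 * (count_indep (Suc n))\<^sup>2"
    by linarith
  then show ?thesis
    by simp
qed

text \<open>
  The support of \<open>count_indep\<close> is an initial segment, so the inequalities for consecutive triples
  chain up.
\<close>

lemma count_indep_ratio:
  assumes "i \<le> k"
  shows "count_indep (Suc k) * count_indep i \<le> count_indep k * count_indep (Suc i)"
  using assms
proof (induction k rule: dec_induct)
  case (step k)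
  show ?case
  proof (cases "count_indep (Suc (Suc k)) = 0")
    case True
    then show ?thesis
      by (simp add: count_indep_nonneg)
  next
    case False
    then have pos: "count_indep k > 0"
      using count_indep_nonneg[of "Suc (Suc k)"] count_indep_pos_Suc by force
    have "count_indep k * (count_indep (Suc (Suc k)) * count_indep i)
        \<le> (count_indep (Suc k))\<^sup>2 * count_indep i"
      using mult_right_mono[OF count_indep_log_concave[of k] count_indep_nonneg[of i]]
      by (simp add: mult.assoc)
    also have "\<dots> \<le> count_indep (Suc k) * (count_indep k * count_indep (Suc i))"
      using mult_left_mono[OF step.IH count_indep_nonneg[of "Suc k"]]
      by (simp add: power2_eq_square mult.assoc)
    finally have "count_indep k * (count_indep (Suc (Suc k)) * count_indep i)
        \<le> count_indep k * (count_indep (Suc k) * count_indep (Suc i))"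
      by (simp add: algebra_simps)
    then show ?thesis
      using pos by simp
  qed
qed simp

lemma sum_over_sizes:
  "(\<Sum>T\<in>I. g (card T)) = (\<Sum>k\<le>card E. g k * count_indep k)" for g :: "nat \<Rightarrow> real"
proof -
  have "(\<Sum>T\<in>I. g (card T)) = (\<Sum>k\<le>card E. \<Sum>T | T \<in> I \<and> card T = k. g (card T))"
    by (rule sum.group[symmetric])
      (use finite_indep finite_ground indep_subset in \<open>auto intro: card_mono\<close>)
  also have "\<dots> = (\<Sum>k\<le>card E. g k * count_indep k)"
    by (intro sum.cong refl) (simp add: count_indep_def)
  finally show ?thesis .
qed

theorem proportion_of_small_indep_sets:
  "real (card {T \<in> I. real (card T) < (\<Sum>T\<in>I. real (card T)) / card I + 1}) / card I \<ge> 1 / exp 1"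
proof -
  define \<mu> where "\<mu> = (\<Sum>T\<in>I. real (card T)) / card I"
  have total: "real (card I) = (\<Sum>k\<le>card E. count_indep k)"
    using sum_over_sizes[of "\<lambda>_. 1"] by simp
  have mean: "(\<Sum>T\<in>I. real (card T)) = (\<Sum>k\<le>card E. real k * count_indep k)"
    by (rule sum_over_sizes)
  have "real (card {T \<in> I. real (card T) < \<mu> + 1}) = (\<Sum>T\<in>I. of_bool (real (card T) < \<mu> + 1))"
    using finite_indep by (simp add: Int_def)
  also have "\<dots> = (\<Sum>k\<le>card E. of_bool (real k < \<mu> + 1) * count_indep k)"
    by (rule sum_over_sizes)
  also have "\<dots> = (\<Sum>k\<le>card E. if real k < \<mu> + 1 then count_indep k else 0)"
    by (intro sum.cong) auto
  also have "\<dots> = (\<Sum>k | k \<le> card E \<and> real k < \<mu> + 1. count_indep k)"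
    by (subst sum.inter_filter[symmetric]) auto
  finally have small: "real (card {T \<in> I. real (card T) < \<mu> + 1})
      = (\<Sum>k | k \<le> card E \<and> real k < \<mu> + 1. count_indep k)" .
  have "count_indep 0 > 0"
  proof -
    have "{} \<in> {T \<in> I. card T = 0}"
      using empty_indep by simp
    then show ?thesis
      using finite_indep by (auto simp: count_indep_def card_gt_0_iff)
  qed
  moreover have "count_indep k = 0" if "k > card E" for k
  proof -
    have "card T \<noteq> k" if "T \<in> I" for T
      using card_mono[OF finite_ground indep_subset[OF that]] \<open>k > card E\<close> by simp
    then have "{T \<in> I. card T = k} = {}"
      by blast
    then show ?thesis
      unfolding count_indep_def by (simp only: card.empty of_nat_0)
  qed
  ultimately have "1 / exp 1 \<le> (\<Sum>k | k \<le> card E \<and> real k < \<mu> + 1. count_indep k) / card I"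
    using log_concave_Feige[of count_indep "card E"] count_indep_nonneg count_indep_ratio
    unfolding \<mu>_def mean total by blast
  then show ?thesis
    unfolding small[symmetric] unfolding \<mu>_def .
qed

end

section \<open>Forests and components of a graph\<close>

definition joined :: "('e \<Rightarrow> 'v set) \<Rightarrow> 'e set \<Rightarrow> ('v \<times> 'v) set" where
  "joined ends F = {(u, v). \<exists>e\<in>F. ends e = {u, v}}\<^sup>*"

lemma joined_refl [simp]: "(v, v) \<in> joined ends F"
  by (simp add: joined_def)

lemma joined_trans: "(u, v) \<in> joined ends F \<Longrightarrow> (v, w) \<in> joined ends F \<Longrightarrow> (u, w) \<in> joined ends F"
  unfolding joined_def by (rule rtrancl_trans)

lemma joined_sym: "(u, v) \<in> joined ends F \<Longrightarrow> (v, u) \<in> joined ends F"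
  unfolding joined_def
  by (rule symD[OF sym_rtrancl]) (auto simp: sym_def insert_commute)

lemma joined_edge: "e \<in> F \<Longrightarrow> ends e = {u, v} \<Longrightarrow> (u, v) \<in> joined ends F"
  by (auto simp: joined_def)

lemma joined_mono: "F \<subseteq> G \<Longrightarrow> (u, v) \<in> joined ends F \<Longrightarrow> (u, v) \<in> joined ends G"
  unfolding joined_def by (rule subsetD[OF rtrancl_mono]) auto

definition simple_path :: "('e \<Rightarrow> 'v set) \<Rightarrow> 'e set \<Rightarrow> 'v list \<Rightarrow> bool" where
  "simple_path ends F vs \<longleftrightarrow> vs \<noteq> [] \<and> distinct vs \<and>
     (\<forall>i. Suc i < length vs \<longrightarrow> (\<exists>e\<in>F. ends e = {vs ! i, vs ! Suc i}))"

lemma joined_imp_simple_path: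
  assumes "(u, v) \<in> joined ends F"
  shows "\<exists>vs. simple_path ends F vs \<and> hd vs = u \<and> last vs = v"
  using assms unfolding joined_def
proof (induction rule: rtrancl_induct)
  case base
  have "simple_path ends F [u]"
    by (simp add: simple_path_def)
  then show ?case
    by force
next
  case (step v w)
  then obtain vs e where vs: "simple_path ends F vs" "hd vs = u" "last vs = v"
    and e: "e \<in> F" "ends e = {v, w}"
    by auto
  show ?case
  proof (cases "w \<in> set vs")
    case True
    then obtain i where i: "i < length vs" "vs ! i = w"
      by (auto simp: in_set_conv_nth)
    have "simple_path ends F (take (Suc i) vs)"
      using vs(1) by (auto simp: simple_path_def)
    moreover have "last (take (Suc i) vs) = w"
      using i by (simp add: take_Suc_conv_app_nth)
    moreover have "hd (take (Suc i) vs) = u"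
      using vs by (cases vs) auto
    ultimately show ?thesis
      by blast
  next
    case False
    have "simple_path ends F (vs @ [w])"
      unfolding simple_path_def
    proof (intro conjI allI impI)
      show "distinct (vs @ [w])"
        using vs(1) False by (simp add: simple_path_def)
      fix i assume i: "Suc i < length (vs @ [w])"
      show "\<exists>e\<in>F. ends e = {(vs @ [w]) ! i, (vs @ [w]) ! Suc i}"
      proof (cases "Suc i < length vs")
        case True
        then show ?thesis
          using vs(1) by (auto simp: simple_path_def nth_append)
      next
        case False
        then have "length vs = Suc i"
          using i by simp
        moreover from this have "vs ! i = v"
          using vs(1,3) by (simp add: simple_path_def last_conv_nth)
        ultimately show ?thesis
          using e by (auto simp: nth_append)
      qed
    qed simp
    moreover have "hd (vs @ [w]) = u"
      using vs by (simp add: simple_path_def)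
    ultimately show ?thesis
      by force
  qed
qed

text \<open>
  The edges of a path with distinct vertices are distinct, since their endpoint sets are, and the
  new edge closes the path to a cycle. A loop is the case of a path with a single vertex.
\<close>

lemma joined_imp_cycle:
  assumes "e \<notin> F" "ends e = {u, v}" "(u, v) \<in> joined ends F"
  shows "\<exists>vs es. is_cycle ends vs es \<and> set es \<subseteq> insert e F"
proof -
  obtain vs where vs: "simple_path ends F vs" "hd vs = u" "last vs = v"
    using joined_imp_simple_path[OF assms(3)] by blast
  define n where "n = length vs - 1"
  have len: "length vs = Suc n"
    using vs(1) by (cases vs) (auto simp: simple_path_def n_def)
  obtain f where f: "\<And>i. i < n \<Longrightarrow> f i \<in> F \<and> ends (f i) = {vs ! i, vs ! Suc i}"
    using vs(1) len unfolding simple_path_def by (metis Suc_less_eq)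
  define es where "es = map f [0..<n] @ [e]"
  have inj: "i = j" if "i < n" "j < n" "f i = f j" for i j
  proof -
    have "{vs ! i, vs ! Suc i} = {vs ! j, vs ! Suc j}"
      using f[OF that(1)] f[OF that(2)] that(3) by simp
    then show ?thesis
      using vs(1) that len by (auto simp: simple_path_def doubleton_eq_iff nth_eq_iff_index_eq)
  qed
  have "distinct es"
    using f assms(1) inj by (auto simp: es_def distinct_map inj_on_def)
  moreover have "ends (es ! i) = {vs ! i, vs ! (Suc i mod length es)}" if "i < length es" for i
  proof (cases "i = n")
    case True
    then show ?thesis
      using vs assms(2) len
      by (auto simp: es_def nth_append hd_conv_nth last_conv_nth simple_path_def insert_commute)
  next
    case False
    then show ?thesis
      using that f by (auto simp: es_def nth_append)
  qed
  ultimately have "is_cycle ends vs es"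
    using vs(1) len by (auto simp: is_cycle_def simple_path_def es_def)
  moreover have "set es \<subseteq> insert e F"
    using f by (auto simp: es_def)
  ultimately show ?thesis
    by blast
qed

lemma cycle_imp_joined:
  assumes cyc: "is_cycle ends vs es" "set es \<subseteq> insert e F" "e \<in> set es" "ends e = {u, v}"
  shows "(u, v) \<in> joined ends F"
proof -
  define n where "n = length es"
  obtain k where k: "k < n" "es ! k = e"
    using cyc(3) by (auto simp: in_set_conv_nth n_def)
  have ends: "ends (es ! i) = {vs ! i, vs ! (Suc i mod n)}" if "i < n" for i
    using cyc(1) that by (auto simp: is_cycle_def n_def)
  have other: "es ! i \<in> F" if "i < n" "i \<noteq> k" for i
  proof -
    have "es ! i \<noteq> e"
      using cyc(1) k that by (auto simp: is_cycle_def n_def nth_eq_iff_index_eq)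
    then show ?thesis
      using cyc(2) that nth_mem[of i es] unfolding n_def by blast
  qed
  \<comment> \<open>Starting behind the edge \<open>e\<close>, go around the cycle until \<open>e\<close> is reached again.\<close>
  have walk: "d < n \<Longrightarrow> (vs ! (Suc k mod n), vs ! ((Suc k + d) mod n)) \<in> joined ends F" for d
  proof (induction d)
    case (Suc d)
    let ?i = "(Suc k + d) mod n"
    have "?i < n"
      using k by simp
    moreover have "?i \<noteq> k"
    proof
      assume "?i = k"
      then have "(k + Suc d) mod n = (k + 0) mod n"
        using k by simp
      then have "n dvd Suc d"
        using mod_eq_dvd_iff_nat[of k "k + Suc d" n] by simp
      then show False
        using Suc.prems by (auto dest: dvd_imp_le)
    qed
    ultimately have "(vs ! ?i, vs ! (Suc ?i mod n)) \<in> joined ends F"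
      using joined_edge[of "es ! ?i" F ends] other[of ?i] ends[of ?i] by blast
    then show ?case
      using Suc joined_trans by (fastforce simp: mod_Suc_eq)
  qed simp
  have "(Suc k + (n - 1)) mod n = k"
    using k by simp
  then have "(vs ! (Suc k mod n), vs ! k) \<in> joined ends F"
    using walk[of "n - 1"] k by simp
  moreover have "{u, v} = {vs ! k, vs ! (Suc k mod n)}"
    using ends[OF k(1)] k(2) cyc(4) by simp
  ultimately show ?thesis
    using joined_sym by (metis doubleton_eq_iff)
qed

lemma insert_sub_forest_iff:
  assumes F: "F \<in> sub_forests E ends" and e: "e \<in> E" "e \<notin> F" "ends e = {u, v}"
  shows "insert e F \<in> sub_forests E ends \<longleftrightarrow> (u, v) \<notin> joined ends F"
proof
  assume "insert e F \<in> sub_forests E ends"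
  then show "(u, v) \<notin> joined ends F"
    using joined_imp_cycle[of e F ends u v] e(2,3) by (auto simp: sub_forests_def)
next
  assume nj: "(u, v) \<notin> joined ends F"
  have "\<not> (is_cycle ends vs es \<and> set es \<subseteq> insert e F)" for vs es
  proof
    assume c: "is_cycle ends vs es \<and> set es \<subseteq> insert e F"
    then have "e \<in> set es"
      using F unfolding sub_forests_def by blast
    then show False
      using cycle_imp_joined[of ends vs es e F u v] c e(3) nj by blast
  qed
  then show "insert e F \<in> sub_forests E ends"
    using F e(1) by (auto simp: sub_forests_def)
qed

lemma joined_insert_iff:
  assumes "ends e = {a, b}"
  shows "(u, v) \<in> joined ends (insert e F) \<longleftrightarrow>
    (u, v) \<in> joined ends F \<or>
    (u, a) \<in> joined ends F \<and> (b, v) \<in> joined ends F \<or>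
    (u, b) \<in> joined ends F \<and> (a, v) \<in> joined ends F"
    (is "?l \<longleftrightarrow> ?r v")
proof
  assume ?l
  then show "?r v"
    unfolding joined_def[of ends "insert e F"]
  proof (induction rule: rtrancl_induct)
    case base
    show ?case by simp
  next
    case (step v w)
    then obtain f where f: "f \<in> insert e F" "ends f = {v, w}"
      by auto
    show ?case
    proof (cases "f \<in> F")
      case True
      then have "(v, w) \<in> joined ends F"
        using joined_edge f(2) by metis
      then show ?thesis
        using step.IH joined_trans by metis
    next
      case False
      then have "v = a \<and> w = b \<or> v = b \<and> w = a"
        using f assms by (auto simp: doubleton_eq_iff)
      then show ?thesis
        using step.IH joined_trans joined_sym joined_refl by metis
    qed
  qed
next
  assume "?r v"
  moreover have "(a, b) \<in> joined ends (insert e F)"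
    using joined_edge assms by (metis insertI1)
  moreover have "(x, y) \<in> joined ends (insert e F)" if "(x, y) \<in> joined ends F" for x y
    using joined_mono[OF _ that] by blast
  ultimately show ?l
    using joined_trans joined_sym by metis
qed

definition component :: "('e \<Rightarrow> 'v set) \<Rightarrow> 'e set \<Rightarrow> 'v \<Rightarrow> 'v set" where
  "component ends F u = joined ends F `` {u}"

lemma component_eq_iff: "component ends F u = component ends F v \<longleftrightarrow> (u, v) \<in> joined ends F"
proof
  assume "component ends F u = component ends F v"
  then have "v \<in> component ends F u"
    by (simp add: component_def)
  then show "(u, v) \<in> joined ends F"
    by (simp add: component_def)
next
  assume "(u, v) \<in> joined ends F"
  then show "component ends F u = component ends F v"
    unfolding component_def by (auto intro: joined_trans joined_sym)
qed

text \<open>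
  Adding \<open>e\<close> closes a cycle in \<open>F + f\<close> exactly if \<open>F + f\<close> joins the endpoints of \<open>e\<close>. As \<open>F\<close> does not,
  the connection uses \<open>f\<close>, so \<open>e\<close> and \<open>f\<close> join the same two components of \<open>F\<close>.
\<close>

lemma (in finite_graph) insert_insert_sub_forest_iff:
  assumes e: "e \<in> E" "e \<notin> F" "insert e F \<in> sub_forests E ends"
    and f: "f \<in> E" "f \<notin> F" "insert f F \<in> sub_forests E ends"
    and "e \<noteq> f"
  shows "insert e (insert f F) \<in> sub_forests E ends \<longleftrightarrow>
    component ends F ` ends e \<noteq> component ends F ` ends f"
proof -
  have F: "F \<in> sub_forests E ends"
    using e(3) by (auto simp: sub_forests_def)
  have ex: "\<exists>a b. ends g = {a, b}" if "g \<in> E" for g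
    using card_ends[OF that] by (auto simp: card_1_singleton_iff card_2_iff)
  obtain a b c d where ab: "ends e = {a, b}" and cd: "ends f = {c, d}"
    using ex e(1) f(1) by metis
  have "(a, b) \<notin> joined ends F"
    using insert_sub_forest_iff[of F E ends e a b] F e ab by simp
  moreover have "insert e (insert f F) \<in> sub_forests E ends \<longleftrightarrow> (a, b) \<notin> joined ends (insert f F)"
    using insert_sub_forest_iff[of "insert f F" E ends e a b] f(3) e(1,2) ab \<open>e \<noteq> f\<close> by simp
  moreover have "component ends F ` ends e = component ends F ` ends f \<longleftrightarrow>
      (a, c) \<in> joined ends F \<and> (d, b) \<in> joined ends F \<or>
      (a, d) \<in> joined ends F \<and> (c, b) \<in> joined ends F"
    unfolding ab cd
    by (simp add: doubleton_eq_iff component_eq_iff) (metis joined_sym)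
  ultimately show ?thesis
    using joined_insert_iff[of ends f c d a b F, OF cd] by simp
qed

theorem corollary1p3:
  fixes V :: "'v set" and E :: "'e set" and ends :: "'e \<Rightarrow> 'v set"
  assumes "finite_graph V E ends"
  shows "real (card {F \<in> sub_forests E ends. real (card F) < avg_forest_size E ends + 1})
           / real (card (sub_forests E ends)) \<ge> 1 / exp 1"
proof -
  interpret finite_graph V E ends
    by (rule assms)
  interpret matroid_with_parallel_classes E "sub_forests E ends" "\<lambda>F e. component ends F ` ends e"
  proof
    show "insert e (insert f F) \<in> sub_forests E ends \<longleftrightarrow>
        component ends F ` ends e \<noteq> component ends F ` ends f"
      if "e \<in> E" "e \<notin> F" "insert e F \<in> sub_forests E ends"
        "f \<in> E" "f \<notin> F" "insert f F \<in> sub_forests E ends" "e \<noteq> f" for e F f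
      using that by (rule insert_insert_sub_forest_iff)
    show "{} \<in> sub_forests E ends"
      by (rule empty_in_sub_forests)
    show "S \<in> sub_forests E ends" if "T \<in> sub_forests E ends" "S \<subseteq> T" for S T
      using that unfolding sub_forests_def by blast
  qed (use finite_E in \<open>auto simp: sub_forests_def\<close>)
  show ?thesis
    using proportion_of_small_indep_sets by (simp add: avg_forest_size_def)
qed

end
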